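(* Let $p = 2(1+2^{1/3}+2^{2/3})^{1/3}$ and $a = 16p^{-3} = 2(2^{1/3}-1)$. Then $$\frac{\varphi(e^{-27\pi\sqrt3})}{\varphi(e^{-\pi\sqrt3})} = 3^{-7/4}\Bigg(1 + \Big(p\frac{1+a\cos\frac{4\pi}{9}}{1-a\cos\frac{\pi}{9}}\Big)^{1/3} + \Big(p\frac{1+a\cos\frac{2\pi}{9}}{1+a\cos\frac{4\pi}{9}}\Big)^{1/3} + 2^{1/3} + \Big(p\frac{1-a\cos\frac{\pi}{9}}{1+a\cos\frac{2\pi}{9}}\Big)^{1/3}\Bigg).$$
   Context: $\varphi(q) := \sum_{n=-\infty}^\infty q^{n^2}$ for $|q|<1$. Roots of positive reals are the positive real roots; cube roots are real. *)

theory Defs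
  imports "HOL-Analysis.Analysis"
begin

(* Meaningful for norm q < 1, where the family q^(n^2), n ranging over all integers,
   is absolutely summable. *)
definition ramanujan_phi :: "'a::{real_normed_field,banach} \<Rightarrow> 'a" where
  "ramanujan_phi q = (\<Sum>\<^sub>\<infinity>n\<in>(UNIV :: int set). q powi (n\<^sup>2))"

end

theory Submission
  imports Defs "HOL-Probability.Characteristic_Functions"
begin

text \<open>With \<open>c = pi sqrt 3\<close> and \<open>\<theta>\<^sub>j = \<Sum>\<^sub>n exp (- c (n + j/9)\<^sup>2)\<close>, theta inversion turns the quotient into
  \<open>3\<close> to the power \<open>-7/4\<close> times \<open>1 + u\<^sub>1 + u\<^sub>2 + u\<^sub>3 + u\<^sub>4\<close> where \<open>u\<^sub>j = 2 \<theta>\<^sub>j / \<theta>\<^sub>0\<close>.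
  Regrouping triple products of Gaussian sums along the vector \<open>(1,1,1)\<close> expresses \<open>u\<^sub>1 u\<^sub>2 u\<^sub>4\<close>,
  \<open>u\<^sub>1\<^sup>2 u\<^sub>4 + u\<^sub>4\<^sup>2 u\<^sub>2 + u\<^sub>2\<^sup>2 u\<^sub>1\<close> and \<open>u\<^sub>1\<^sup>2 u\<^sub>2 + u\<^sub>2\<^sup>2 u\<^sub>4 + u\<^sub>4\<^sup>2 u\<^sub>1\<close> through \<open>u\<^sub>3\<close> and one more modular
  function; a quartic theta identity together with inversion evaluates these two, giving \<open>u\<^sub>3 = root 3 2\<close>.
  So \<open>u\<^sub>2\<^sup>2 u\<^sub>1\<close>, \<open>u\<^sub>1\<^sup>2 u\<^sub>4\<close>, \<open>u\<^sub>4\<^sup>2 u\<^sub>2\<close> are the roots of an explicit cubic, whose roots are proportional to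
  \<open>1 + a cos (2 pi j / 9)\<close> for \<open>j = 1, 2, 4\<close>. The dual theta series shows that both triples are decreasing,
  which matches them, and \<open>u\<^sub>1\<^sup>3 = u\<^sub>1 u\<^sub>2 u\<^sub>4 (u\<^sub>1\<^sup>2 u\<^sub>4) / (u\<^sub>4\<^sup>2 u\<^sub>2)\<close> and its analogues give the \<open>u\<^sub>j\<close>.\<close>

section \<open>Gaussian sums\<close>

text \<open>A Jacobi theta function with characteristic \<open>\<alpha>\<close> and nome
  \<open>exp (- c)\<close>. As a function of \<open>\<alpha>\<close> it is the 1-periodization of a
  Gaussian, the form on which Poisson summation acts.\<close>

definition gauss_sum :: "real \<Rightarrow> real \<Rightarrow> real" where
  "gauss_sum c \<alpha> = (\<Sum>\<^sub>\<infinity>n\<in>(UNIV :: int set). exp (- (c * (of_int n + \<alpha>)\<^sup>2)))"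

lemma summable_on_power_abs_int:
  fixes r :: real
  assumes "0 \<le> r" "r < 1"
  shows "(\<lambda>n::int. r ^ nat \<bar>n\<bar>) summable_on UNIV"
proof -
  have nat: "(\<lambda>n::nat. r ^ n) summable_on UNIV"
    using assms by (intro summable_nonneg_imp_summable_on summable_geometric) auto
  have 1: "(\<lambda>n::int. r ^ nat \<bar>n\<bar>) summable_on {0..}"
    by (subst summable_on_reindex_bij_witness[of _ int nat UNIV "\<lambda>n. r ^ n"]) (use nat in auto)
  have 2: "(\<lambda>n::int. r ^ nat \<bar>n\<bar>) summable_on {..0}"
    by (subst summable_on_reindex_bij_witness[of _ "\<lambda>n. - int n" "\<lambda>n. nat (- n)" UNIV "\<lambda>n. r ^ n"])
       (use nat in auto)
  have "(\<lambda>n::int. r ^ nat \<bar>n\<bar>) summable_on ({0..} \<union> ({..0} - {0..}))"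
    by (intro summable_on_Un_disjoint 1 summable_on_subset_banach[OF 2]) auto
  also have "{0..} \<union> ({..0} - {0..}) = (UNIV :: int set)"
    by auto
  finally show ?thesis .
qed

lemma int_abs_le_square: "\<bar>n\<bar> \<le> (n::int)\<^sup>2"
  by (cases "n = 0") (use mult_right_mono[of 1 "\<bar>n\<bar>" "\<bar>n\<bar>"] in \<open>auto simp: power2_eq_square\<close>)

text \<open>Nonnegativity of (n + 2 alpha)^2 bounds n^2 by 2 (n + alpha)^2 + 2 alpha^2, and |n| <=
  n^2 for integers. Since alpha enters only through a factor, the geometric majorant is uniform for
  alpha in [0,1].\<close>

lemma exp_square_shift_le:
  fixes c \<alpha> :: real
  assumes "c > 0"
  shows "exp (- (c * (of_int n + \<alpha>)\<^sup>2)) \<le> exp (c * \<alpha>\<^sup>2) * exp (- c / 2) ^ nat \<bar>n\<bar>"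
proof -
  have "real_of_int \<bar>n\<bar> \<le> of_int (n\<^sup>2)"
    by (intro of_int_le_iff[THEN iffD2] int_abs_le_square)
  moreover have "(of_int n)\<^sup>2 \<le> 2 * (of_int n + \<alpha>)\<^sup>2 + 2 * \<alpha>\<^sup>2"
    using zero_le_power2[of "of_int n + 2 * \<alpha>"] by (simp add: power2_eq_square algebra_simps)
  ultimately have "real_of_int \<bar>n\<bar> / 2 \<le> (of_int n + \<alpha>)\<^sup>2 + \<alpha>\<^sup>2"
    by simp
  then have "c * (real_of_int \<bar>n\<bar> / 2) \<le> c * ((of_int n + \<alpha>)\<^sup>2 + \<alpha>\<^sup>2)"
    using assms by (intro mult_left_mono) auto
  then have "- (c * (of_int n + \<alpha>)\<^sup>2) \<le> c * \<alpha>\<^sup>2 + real (nat \<bar>n\<bar>) * (- c / 2)"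
    by (simp add: algebra_simps)
  then show ?thesis
    by (simp add: exp_of_nat_mult[symmetric] flip: exp_add)
qed

lemma summable_on_gauss:
  fixes c \<alpha> :: real
  assumes "c > 0"
  shows "(\<lambda>n::int. exp (- (c * (of_int n + \<alpha>)\<^sup>2))) summable_on UNIV"
proof (rule summable_on_comparison_test)
  show "(\<lambda>n::int. exp (c * \<alpha>\<^sup>2) * exp (- c / 2) ^ nat \<bar>n\<bar>) summable_on UNIV"
    using assms by (intro summable_on_cmult_right summable_on_power_abs_int) auto
qed (use exp_square_shift_le[OF assms] in auto)

lemma has_sum_gauss:
  fixes c \<alpha> :: real
  assumes "c > 0"
  shows "((\<lambda>n::int. exp (- (c * (of_int n + \<alpha>)\<^sup>2))) has_sum gauss_sum c \<alpha>) UNIV"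
  unfolding gauss_sum_def by (rule has_sum_infsum[OF summable_on_gauss[OF assms]])

lemma gauss_sum_pos:
  assumes "c > 0"
  shows "gauss_sum c \<alpha> > 0"
proof -
  have "exp (- (c * (of_int 0 + \<alpha>)\<^sup>2)) \<le> gauss_sum c \<alpha>"
    using finite_sum_le_has_sum[OF has_sum_gauss[OF assms, of \<alpha>], of "{0}"] by simp
  then show ?thesis
    using exp_gt_zero order_less_le_trans by blast
qed

lemma gauss_sum_add_int: "gauss_sum c (\<alpha> + of_int k) = gauss_sum c \<alpha>"
  unfolding gauss_sum_def
  by (rule infsum_reindex_bij_witness[of _ "\<lambda>n. n - k" "\<lambda>n. n + k"]) (auto simp: algebra_simps)

lemma gauss_sum_uminus: "gauss_sum c (- \<alpha>) = gauss_sum c \<alpha>"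
  unfolding gauss_sum_def
  by (rule infsum_reindex_bij_witness[of _ uminus uminus]) (auto simp: power2_commute)

lemma has_sum_times_nonneg:
  fixes f g :: "_ \<Rightarrow> real"
  assumes "(f has_sum a) A" "(g has_sum b) B" "\<And>x. x \<in> A \<Longrightarrow> f x \<ge> 0" "\<And>x. x \<in> B \<Longrightarrow> g x \<ge> 0"
  shows "((\<lambda>(x, y). f x * g y) has_sum (a * b)) (A \<times> B)"
proof (rule has_sum_SigmaI)
  show f: "((\<lambda>y. case (x, y) of (x, y) \<Rightarrow> f x * g y) has_sum (f x * b)) B" for x
    using has_sum_cmult_right[OF assms(2)] by simp
  show g: "((\<lambda>x. f x * b) has_sum (a * b)) A"
    by (rule has_sum_cmult_left[OF assms(1)])
  show "(\<lambda>(x, y). f x * g y) summable_on A \<times> B"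
    by (rule summable_on_SigmaI[OF f has_sum_imp_summable[OF g]]) (use assms in auto)
qed

text \<open>The summation index is split by its residue modulo m, as k = m n + j.\<close>

lemma gauss_sum_multisection:
  assumes "c > 0" "m > 0"
  shows "gauss_sum c \<alpha> = (\<Sum>j<m. gauss_sum (c * (real m)\<^sup>2) ((\<alpha> + real j) / real m))"
proof -
  have "((\<lambda>(j, n). exp (- (c * (real m)\<^sup>2 * (of_int n + (\<alpha> + real j) / real m)\<^sup>2)))
      has_sum gauss_sum c \<alpha>) ({..<m} \<times> (UNIV :: int set)) \<longleftrightarrow>
    ((\<lambda>n::int. exp (- (c * (of_int n + \<alpha>)\<^sup>2))) has_sum gauss_sum c \<alpha>) UNIV"
  proof (rule has_sum_reindex_bij_witness[of _ "\<lambda>k. (nat (k mod int m), k div int m)"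
        "\<lambda>(j, n). int m * n + int j"], goal_cases)
    case (5 x)
    obtain j n where x: "x = (j, n)" by force
    have "(real m)\<^sup>2 * (of_int n + (\<alpha> + real j) / real m)\<^sup>2 = (real m * of_int n + real j + \<alpha>)\<^sup>2"
      using assms(2) by (simp add: field_simps flip: power_mult_distrib)
    then show ?case
      by (simp add: x mult.assoc)
  qed (use assms(2) in \<open>auto simp: nat_less_iff nat_add_distrib\<close>)
  then have "((\<lambda>(j, n). exp (- (c * (real m)\<^sup>2 * (of_int n + (\<alpha> + real j) / real m)\<^sup>2)))
      has_sum gauss_sum c \<alpha>) ({..<m} \<times> (UNIV :: int set))"
    using has_sum_gauss[OF assms(1)] by simp
  then have "((\<lambda>j. gauss_sum (c * (real m)\<^sup>2) ((\<alpha> + real j) / real m)) has_sum gauss_sum c \<alpha>) {..<m}"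
    by (rule has_sum_SigmaD) (use assms in \<open>auto intro!: has_sum_gauss\<close>)
  then show ?thesis
    by (simp add: has_sum_finite_iff)
qed

text \<open>Splitting \<open>w \<in> \<real>\<^sup>3\<close> into its components along and orthogonal to \<open>(1,1,1)\<close> gives
  \<open>3 |w|\<^sup>2 = (w\<^sub>1 + w\<^sub>2 + w\<^sub>3)\<^sup>2 + \<Sum> (w\<^sub>i - w\<^sub>j)\<^sup>2\<close>; this is the sum of the orthogonal parts over the
  translates of \<open>(\<alpha>, \<beta>, \<gamma>)\<close> by integer vectors of coordinate sum zero.\<close>

definition planar_sum :: "real \<Rightarrow> real \<Rightarrow> real \<Rightarrow> real \<Rightarrow> real" where
  "planar_sum c \<alpha> \<beta> \<gamma> = (\<Sum>\<^sub>\<infinity>(m, n)\<in>(UNIV :: (int \<times> int) set).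
     exp (- (c / 3 * ((\<alpha> - \<beta> - 2 * of_int m - of_int n)\<^sup>2 + (\<beta> - \<gamma> + of_int m - of_int n)\<^sup>2
       + (\<gamma> - \<alpha> + of_int m + 2 * of_int n)\<^sup>2))))"

section \<open>Invariance of planar sums, and products of three Gaussian sums\<close>

lemma planar_sum_translate: "planar_sum c (\<alpha> + d) (\<beta> + d) (\<gamma> + d) = planar_sum c \<alpha> \<beta> \<gamma>"
  unfolding planar_sum_def by simp

lemma planar_sum_rotate: "planar_sum c \<beta> \<gamma> \<alpha> = planar_sum c \<alpha> \<beta> \<gamma>"
  unfolding planar_sum_def
  by (rule infsum_reindex_bij_witness[of _ "\<lambda>(m, n). (n, - m - n)" "\<lambda>(m, n). (- m - n, m)"])
     (auto simp: algebra_simps)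

text \<open>The vector (-k-l, k, l) has coordinate sum zero, so adding it only permutes the
  translates.\<close>

lemma planar_sum_transfer:
  "planar_sum c (\<alpha> - of_int k - of_int l) (\<beta> + of_int k) (\<gamma> + of_int l) = planar_sum c \<alpha> \<beta> \<gamma>"
  unfolding planar_sum_def
  by (rule infsum_reindex_bij_witness[of _ "\<lambda>(m, n). (m - k, n - l)" "\<lambda>(m, n). (m + k, n + l)"])
     (auto simp: algebra_simps)

text \<open>The integer vectors (a, m, n) are sliced by their coordinate sum N = a + m + n. The
  component along (1,1,1) is constant on a slice, and the slice is (N, 0, 0) plus the zero-sum
  vectors (-m-n, m, n), whose orthogonal parts give \<open>planar_sum\<close>.\<close>

lemma gauss_sum_triple:
  assumes c: "c > 0"
  shows "((\<lambda>N::int. exp (- (c / 3 * (of_int N + \<alpha> + \<beta> + \<gamma>)\<^sup>2)) * planar_sum c (\<alpha> + of_int N) \<beta> \<gamma>)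
    has_sum (gauss_sum c \<alpha> * (gauss_sum c \<beta> * gauss_sum c \<gamma>))) UNIV"
proof -
  define e where "e \<alpha> n = exp (- (c * (of_int n + \<alpha>)\<^sup>2))" for \<alpha> and n :: int
  define f where "f = (\<lambda>(N, m, n). exp (- (c / 3 * (of_int N + \<alpha> + \<beta> + \<gamma>)\<^sup>2)) *
    exp (- (c / 3 * ((\<alpha> + of_int N - \<beta> - 2 * of_int m - of_int n)\<^sup>2 + (\<beta> - \<gamma> + of_int m - of_int n)\<^sup>2
       + (\<gamma> - (\<alpha> + of_int N) + of_int m + 2 * of_int n)\<^sup>2))))"
  have e: "(e \<alpha> has_sum gauss_sum c \<alpha>) UNIV" "e \<alpha> n \<ge> 0" for \<alpha> n
    using has_sum_gauss[OF c, of \<alpha>] by (auto simp: e_def[abs_def])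
  have "((\<lambda>(a, p). e \<alpha> a * (case p of (m, n) \<Rightarrow> e \<beta> m * e \<gamma> n))
    has_sum (gauss_sum c \<alpha> * (gauss_sum c \<beta> * gauss_sum c \<gamma>))) (UNIV \<times> (UNIV \<times> UNIV))"
    by (intro has_sum_times_nonneg e) (auto simp: e)
  also have "?this \<longleftrightarrow> (f has_sum (gauss_sum c \<alpha> * (gauss_sum c \<beta> * gauss_sum c \<gamma>))) (UNIV \<times> (UNIV \<times> UNIV))"
  proof (rule has_sum_reindex_bij_witness[of _ "\<lambda>(N, m, n). (N - m - n, m, n)"
        "\<lambda>(a, m, n). (a + m + n, m, n)"], goal_cases)
    case (5 x)
    obtain a m n where x: "x = (a, m, n)" by (cases x) auto
    have "f (a + m + n, m, n) = e \<alpha> a * (e \<beta> m * e \<gamma> n)"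
      unfolding f_def e_def prod.case exp_add[symmetric]
      by (rule arg_cong[where f = exp]) (simp add: field_simps power2_eq_square)
    then show ?case by (simp add: x)
  qed auto
  finally have f: "(f has_sum (gauss_sum c \<alpha> * (gauss_sum c \<beta> * gauss_sum c \<gamma>))) (UNIV \<times> UNIV)"
    by simp
  have inner: "(\<lambda>p. f (N, p)) summable_on UNIV" for N
    by (rule summable_on_SigmaD1[of "\<lambda>N p. f (N, p)" UNIV "\<lambda>_. UNIV"])
       (use has_sum_imp_summable[OF f] in simp_all)
  have "((\<lambda>N. \<Sum>\<^sub>\<infinity>p. f (N, p)) has_sum (gauss_sum c \<alpha> * (gauss_sum c \<beta> * gauss_sum c \<gamma>))) UNIV"
    by (rule has_sum_SigmaD[OF f]) (rule has_sum_infsum[OF inner])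
  also have "(\<lambda>N. \<Sum>\<^sub>\<infinity>p. f (N, p)) = (\<lambda>N. exp (- (c / 3 * (of_int N + \<alpha> + \<beta> + \<gamma>)\<^sup>2)) *
      planar_sum c (\<alpha> + of_int N) \<beta> \<gamma>)"
    unfolding f_def planar_sum_def
    by (simp add: case_prod_unfold infsum_cmult_right' diff_diff_eq)
  finally show ?thesis .
qed

lemma int_shift_invariant:
  fixes f :: "int \<Rightarrow> 'a"
  assumes "\<And>N. f (N + 1) = f N"
  shows "f N = f 0"
proof (induction N rule: int_induct[of _ 0])
  case (step2 i)
  then show ?case using assms[of "i - 1"] by simp
qed (use assms in auto)

text \<open>In the plane, (N+1, 1/3, 2/3) rotates to (1/3, 2/3, N+1), translates to (0, 1/3, N+2/3)
  and transfers to (N, 1/3, 2/3). So the planar factor does not depend on N and comes out of the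
  sum; what remains along (1,1,1) is a single Gaussian sum.\<close>

lemma gauss_sum_product:
  assumes c: "c > 0"
  obtains C where "\<And>\<alpha>. gauss_sum c \<alpha> * (gauss_sum c (\<alpha> + 1/3) * gauss_sum c (\<alpha> + 2/3)) = C * gauss_sum (c / 3) (3 * \<alpha>)"
proof
  fix \<alpha>
  define K where "K N = planar_sum c (of_int N) (1/3) (2/3)" for N
  have "K (N + 1) = K N" for N
  proof -
    have "K (N + 1) = planar_sum c (1/3) (2/3) (of_int N + 1)"
      by (simp add: K_def planar_sum_rotate)
    also have "\<dots> = planar_sum c 0 (1/3) (2/3 + of_int N)"
      using planar_sum_translate[of c 0 "1/3" "1/3" "2/3 + of_int N"] by (simp add: add.commute add.left_commute)
    also have "\<dots> = K N"
      using planar_sum_transfer[of c "of_int N" 0 N "1/3" "2/3"] by (simp add: K_def)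
    finally show ?thesis .
  qed
  then have K: "K N = K 0" for N
    by (rule int_shift_invariant)
  have "planar_sum c (\<alpha> + of_int N) (\<alpha> + 1/3) (\<alpha> + 2/3) = K 0" for N
    using planar_sum_translate[of c "of_int N" \<alpha> "1/3" "2/3"] K[of N] by (simp add: K_def add_ac)
  moreover have "of_int N + \<alpha> + (\<alpha> + 1/3) + (\<alpha> + 2/3) = of_int N + (3 * \<alpha> + of_int 1)" for N
    by simp
  ultimately have "((\<lambda>N::int. exp (- (c / 3 * (of_int N + (3 * \<alpha> + of_int 1))\<^sup>2)) * K 0) has_sum
    (gauss_sum c \<alpha> * (gauss_sum c (\<alpha> + 1/3) * gauss_sum c (\<alpha> + 2/3)))) UNIV"
    using gauss_sum_triple[OF c, of \<alpha> "\<alpha> + 1/3" "\<alpha> + 2/3"] by (simp only:)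
  moreover have "((\<lambda>N::int. exp (- (c / 3 * (of_int N + (3 * \<alpha> + of_int 1))\<^sup>2)) * K 0) has_sum
      (gauss_sum (c / 3) (3 * \<alpha> + of_int 1) * K 0)) UNIV"
    by (intro has_sum_cmult_left has_sum_gauss) (use c in simp)
  ultimately have "gauss_sum c \<alpha> * (gauss_sum c (\<alpha> + 1/3) * gauss_sum c (\<alpha> + 2/3)) =
      gauss_sum (c / 3) (3 * \<alpha> + of_int 1) * K 0"
    by (rule has_sum_unique)
  then show "gauss_sum c \<alpha> * (gauss_sum c (\<alpha> + 1/3) * gauss_sum c (\<alpha> + 2/3)) = K 0 * gauss_sum (c / 3) (3 * \<alpha>)"
    unfolding gauss_sum_add_int by (simp add: mult.commute)
qed

text \<open>For one summand the planar factor \<open>K\<close> only has period 3 in N. Passing to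
  the next summand shifts N by one, so in the cyclic sum the planar factors add up over a full
  period and become constant.\<close>

lemma gauss_sum_cyclic:
  assumes c: "c > 0"
  obtains C where "\<And>\<alpha>. (gauss_sum c \<alpha>)\<^sup>2 * gauss_sum c (\<alpha> + 1/3) + (gauss_sum c (\<alpha> + 1/3))\<^sup>2 * gauss_sum c (\<alpha> + 2/3)
    + (gauss_sum c (\<alpha> + 2/3))\<^sup>2 * gauss_sum c \<alpha> = C * gauss_sum (c / 3) (3 * \<alpha> + 1/3)"
proof
  fix \<alpha>
  define K where "K N = planar_sum c (of_int N) 0 (1/3)" for N
  define E where "E N = exp (- (c / 3 * (of_int N + (3 * \<alpha> + 1/3))\<^sup>2))" for N :: int
  \<comment> \<open>Transfer takes (N+3, 0, 1/3) to (N+1, 1, 4/3), which is (N, 0, 1/3) translated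
    by 1.\<close>
  have K3: "K (N + 3) = K N" for N
    using planar_sum_transfer[of c "of_int (N + 3)" 1 1 0 "1/3"] planar_sum_translate[of c "of_int N" 1 0 "1/3"]
    by (simp add: K_def add_ac)
  define B where "B N = K N + K (N - 1) + K (N - 2)" for N
  have "B (N + 1) = B N" for N
    using K3[of "N - 2"] by (simp add: B_def add.commute)
  then have B: "B N = B 0" for N
    by (rule int_shift_invariant)
  have *: "((\<lambda>N. E N * K (N - int j)) has_sum
      ((gauss_sum c (\<alpha> + real j / 3))\<^sup>2 * gauss_sum c (\<alpha> + real j / 3 + 1/3))) UNIV" for j
  proof -
    define \<beta> where "\<beta> = \<alpha> + real j / 3"
    have "planar_sum c (\<beta> + of_int N) \<beta> (\<beta> + 1/3) = K N" for N
      using planar_sum_translate[of c "of_int N" \<beta> 0 "1/3"] by (simp add: K_def add_ac)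
    then have "((\<lambda>N::int. exp (- (c / 3 * (of_int N + \<beta> + \<beta> + (\<beta> + 1/3))\<^sup>2)) * K N) has_sum
        ((gauss_sum c \<beta>)\<^sup>2 * gauss_sum c (\<beta> + 1/3))) UNIV"
      using gauss_sum_triple[OF c, of \<beta> \<beta> "\<beta> + 1/3"] by (simp add: power2_eq_square mult.assoc)
    also have "?this \<longleftrightarrow> ((\<lambda>N. E N * K (N - int j)) has_sum ((gauss_sum c \<beta>)\<^sup>2 * gauss_sum c (\<beta> + 1/3))) UNIV"
      by (rule has_sum_reindex_bij_witness[of _ "\<lambda>N. N - int j" "\<lambda>N. N + int j"])
         (auto simp: E_def \<beta>_def algebra_simps)
    finally show ?thesis by (simp add: \<beta>_def)
  qed
  have "((\<lambda>N. E N * K (N - int 0) + E N * K (N - int 1) + E N * K (N - int 2)) has_sum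
    ((gauss_sum c \<alpha>)\<^sup>2 * gauss_sum c (\<alpha> + 1/3) + (gauss_sum c (\<alpha> + 1/3))\<^sup>2 * gauss_sum c (\<alpha> + 2/3)
    + (gauss_sum c (\<alpha> + 2/3))\<^sup>2 * gauss_sum c \<alpha>)) UNIV" (is "(_ has_sum ?S) _")
    \<comment> \<open>For j = 2 the second characteristic is \<open>\<alpha> + 1\<close>, which
      periodicity brings back to \<open>\<alpha>\<close>.\<close>
    using *[of 0] *[of 1] *[of 2] gauss_sum_add_int[of c \<alpha> 1]
    by (intro has_sum_add) (simp_all add: add.assoc)
  also have "(\<lambda>N. E N * K (N - int 0) + E N * K (N - int 1) + E N * K (N - int 2)) = (\<lambda>N. E N * B 0)"
  proof
    fix N
    have "E N * K (N - int 0) + E N * K (N - int 1) + E N * K (N - int 2) = E N * B N"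
      by (simp add: B_def algebra_simps)
    then show "E N * K (N - int 0) + E N * K (N - int 1) + E N * K (N - int 2) = E N * B 0"
      using B[of N] by simp
  qed
  finally have "((\<lambda>N. E N * B 0) has_sum ?S) UNIV" .
  moreover have "((\<lambda>N. E N * B 0) has_sum (gauss_sum (c / 3) (3 * \<alpha> + 1/3) * B 0)) UNIV"
    unfolding E_def by (intro has_sum_cmult_left has_sum_gauss) (use c in simp)
  ultimately have "?S = gauss_sum (c / 3) (3 * \<alpha> + 1/3) * B 0"
    by (rule has_sum_unique)
  then show "?S = B 0 * gauss_sum (c / 3) (3 * \<alpha> + 1/3)"
    by (simp add: mult.commute)
qed

text \<open>Theta series of the tetracode lattice: the \<open>w \<in> \<int>\<^sup>4\<close> with \<open>w\<^sub>0 \<equiv> w\<^sub>1 - w\<^sub>2\<close> and \<open>w\<^sub>1 + w\<^sub>2 + w\<^sub>3 \<equiv> 0\<close> modulo 3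
  form \<open>M \<int>\<^sup>4\<close> for the matrix \<open>M\<close> with rows \<open>(0,1,1,1)\<close>, \<open>(1,0,1,-1)\<close>, \<open>(1,-1,0,1)\<close>, \<open>(1,1,-1,0)\<close>,
  which satisfies \<open>M M\<^sup>T = 3 I\<close>. Below \<open>w = 3 n + (i - j, i, j, - i - j)\<close>.\<close>

lemma gauss_sum_fourth_power:
  assumes c: "c > 0"
  shows "(gauss_sum (3 * c) 0) ^ 4 = (gauss_sum (9 * c) 0) ^ 4 + 8 * gauss_sum (9 * c) 0 * (gauss_sum (9 * c) (1/3)) ^ 3"
proof -
  define e where "e = (\<lambda>n::int. exp (- (3 * c * (of_int n + 0)\<^sup>2)))"
  define h where "h \<alpha> n = exp (- (9 * c * (of_int n + \<alpha>)\<^sup>2))" for \<alpha> and n :: int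
  define g where "g = (\<lambda>(i::int) (j::int). gauss_sum (9 * c) (of_int (i - j) / 3) * (gauss_sum (9 * c) (of_int i / 3) *
    (gauss_sum (9 * c) (of_int j / 3) * gauss_sum (9 * c) (of_int (- i - j) / 3))))"
  define f where "f = (\<lambda>((i, j), (n0, n1, n2, n3)). h (of_int (i - j) / 3) n0 * (h (of_int i / 3) n1 *
      (h (of_int j / 3) n2 * h (of_int (- i - j) / 3) n3)))"
  have e: "(e has_sum gauss_sum (3 * c) 0) UNIV" "e n \<ge> 0" for n
    using has_sum_gauss[of "3 * c" 0] c by (auto simp: e_def)
  have h: "(h \<alpha> has_sum gauss_sum (9 * c) \<alpha>) UNIV" "h \<alpha> n \<ge> 0" for \<alpha> n
    using has_sum_gauss[of "9 * c" \<alpha>] c by (auto simp: h_def[abs_def])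
  have "((\<lambda>(a, p). e a * (case p of (b, q) \<Rightarrow> e b * (case q of (u, v) \<Rightarrow> e u * e v))) has_sum
      (gauss_sum (3 * c) 0 * (gauss_sum (3 * c) 0 * (gauss_sum (3 * c) 0 * gauss_sum (3 * c) 0))))
      (UNIV \<times> (UNIV \<times> (UNIV \<times> UNIV)))" (is "(?F has_sum ?S) _")
    by (intro has_sum_times_nonneg e) (auto simp: e)
  moreover have "(f has_sum ?S) (({0..2} \<times> {0..2}) \<times> UNIV) \<longleftrightarrow>
      (?F has_sum ?S) (UNIV \<times> (UNIV \<times> (UNIV \<times> UNIV)))"
  \<comment> \<open>With w = M v, the first map reads i, n1 and j, n2 off w1 and w2 by division by
    3, and then n0, n3 off w0 and w3. The second map is v = M^T w / 3.\<close>
  proof (rule has_sum_reindex_bij_witness[of _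
      "\<lambda>(v0, v1, v2, v3). (((v0 + v2 - v3) mod 3, (v0 - v1 + v3) mod 3),
         (v1 + v2 + v3 - (v0 + v2 - v3) mod 3 + (v0 - v1 + v3) mod 3) div 3,
         (v0 + v2 - v3) div 3, (v0 - v1 + v3) div 3,
         (v0 + v1 - v2 + (v0 + v2 - v3) mod 3 + (v0 - v1 + v3) mod 3) div 3)"
      "\<lambda>((i, j), (n0, n1, n2, n3)). (n1 + n2 + n3, n0 - n2 + n3 - j, n0 + n1 - n3 + i, n0 - n1 + n2)"], goal_cases)
    case (1 x)
    obtain i j n0 n1 n2 n3 where x: "x = ((i, j), (n0, n1, n2, n3))" by (metis surj_pair)
    from 1 x have ij: "i \<ge> 0" "i \<le> 2" "j \<ge> 0" "j \<le> 2" by auto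
    have "(n1 + n2 + n3) + (n0 + n1 - n3 + i) - (n0 - n1 + n2) = 3 * n1 + i"
      "(n1 + n2 + n3) - (n0 - n2 + n3 - j) + (n0 - n1 + n2) = 3 * n2 + j"
      "(n0 - n2 + n3 - j) + (n0 + n1 - n3 + i) + (n0 - n1 + n2) - i + j = 3 * n0"
      "(n1 + n2 + n3) + (n0 - n2 + n3 - j) - (n0 + n1 - n3 + i) + i + j = 3 * n3"
      by simp_all
    moreover have "(3 * n1 + i) mod 3 = i" "(3 * n2 + j) mod 3 = j" "(3 * n1 + i) div 3 = n1" "(3 * n2 + j) div 3 = n2"
      using ij by auto
    ultimately show ?case by (simp add: x)
  next
    case (3 x)
    obtain v0 v1 v2 v3 where x: "x = (v0, v1, v2, v3)" by (metis surj_pair)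
    define i n1 j n2 where d: "i = (v0 + v2 - v3) mod 3" "n1 = (v0 + v2 - v3) div 3"
      "j = (v0 - v1 + v3) mod 3" "n2 = (v0 - v1 + v3) div 3"
    have 1: "v0 + v2 - v3 = 3 * n1 + i" "v0 - v1 + v3 = 3 * n2 + j"
      by (simp_all add: d)
    have 2: "v1 + v2 + v3 - i + j = 3 * (v3 + n1 - n2)" "v0 + v1 - v2 + i + j = 3 * (v0 - n1 - n2)"
      using 1 by simp_all
    have "(v1 + v2 + v3 - i + j) div 3 = v3 + n1 - n2" "(v0 + v1 - v2 + i + j) div 3 = v0 - n1 - n2"
      unfolding 2 by simp_all
    then show ?case
      unfolding x prod.case d[symmetric] using 1 by simp
  next
    case (5 x)
    obtain i j n0 n1 n2 n3 where x: "x = ((i, j), (n0, n1, n2, n3))" by (metis surj_pair)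
    \<comment> \<open>Here |w|^2 = 3 |v|^2, and the factor 9 in \<open>h\<close> comes from dividing
      w by 3.\<close>
    have "e (n1 + n2 + n3) * (e (n0 - n2 + n3 - j) * (e (n0 + n1 - n3 + i) * e (n0 - n1 + n2))) =
      h (of_int (i - j) / 3) n0 * (h (of_int i / 3) n1 * (h (of_int j / 3) n2 * h (of_int (- i - j) / 3) n3))"
      unfolding e_def h_def exp_add[symmetric]
      by (rule arg_cong[where f = exp]) (simp add: field_simps power2_eq_square)
    then show ?case by (simp add: x f_def)
  qed auto
  ultimately have "(f has_sum ?S) (({0..2} \<times> {0..2}) \<times> UNIV)"
    by simp
  then have "((\<lambda>(i, j). g i j) has_sum ?S) ({0..2} \<times> {0..2})"
  proof (rule has_sum_SigmaD)
    fix x :: "int \<times> int" 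
    obtain i j where x: "x = (i, j)" by force
    have "((\<lambda>(n0, p). h (of_int (i - j) / 3) n0 * (case p of (n1, q) \<Rightarrow> h (of_int i / 3) n1 *
        (case q of (n2, n3) \<Rightarrow> h (of_int j / 3) n2 * h (of_int (- i - j) / 3) n3))) has_sum g i j)
        (UNIV \<times> (UNIV \<times> (UNIV \<times> UNIV)))"
      unfolding g_def by (intro has_sum_times_nonneg h) (auto simp: h)
    then show "((\<lambda>y. f (x, y)) has_sum (case x of (i, j) \<Rightarrow> g i j)) UNIV"
      by (simp add: x f_def case_prod_unfold)
  qed
  then have S: "?S = (\<Sum>i\<in>{0..2}. \<Sum>j\<in>{0..2}. g i j)"
    by (simp add: has_sum_finite_iff sum.cartesian_product)
  have "{0..2} = {0, 1, 2::int}"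
    by auto
  moreover define t where "t k = gauss_sum (9 * c) (of_int k / 3)" for k
  have "t (k + 3) = t k" "t (- k) = t k" for k
    using gauss_sum_add_int[of "9 * c" "of_int k / 3" 1] gauss_sum_uminus[of "9 * c" "of_int k / 3"]
    by (simp_all add: t_def add_divide_distrib)
  note this(1)[of "-4"] this(1)[of "-3"] this(1)[of "-2"] this(1)[of "-1"] this(2)[of 1]
  then have "t (- 4) = t 1" "t (- 3) = t 0" "t (- 2) = t 1" "t (- 1) = t 1" "t 2 = t 1"
    by simp_all
  moreover have "g i j = t (i - j) * (t i * (t j * t (- i - j)))" for i j
    by (simp add: g_def t_def)
  \<comment> \<open>\<open>t k\<close> depends only on whether 3 divides k. The zero codeword gives
    \<open>t 0 ^ 4\<close>; each of the eight others has exactly one zero coordinate and gives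
    \<open>t 0 * t 1 ^ 3\<close>.\<close>
  ultimately have "?S = t 0 ^ 4 + 8 * t 0 * t 1 ^ 3"
    unfolding S by (simp add: power3_eq_cube power4_eq_xxxx algebra_simps)
  then show ?thesis
    by (simp add: t_def power4_eq_xxxx mult.assoc)
qed

section \<open>Poisson summation\<close>

text \<open>Up to normalization this is the real part of the characteristic function of the standard
  normal distribution.\<close>

lemma gaussian_cos_integral_std:
  "integrable lborel (\<lambda>x. exp (- x\<^sup>2 / 2) * cos (t * x))" (is ?I)
  "(LINT x|lborel. exp (- x\<^sup>2 / 2) * cos (t * x)) = sqrt (2 * pi) * exp (- t\<^sup>2 / 2)" (is ?E)
proof -
  interpret real_distribution std_normal_distribution
    by (rule real_dist_normal_dist)
  have d: "std_normal_density x = exp (- x\<^sup>2 / 2) / sqrt (2 * pi)" for x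
    by (simp add: std_normal_density_def)
  have 1: "complex_integrable std_normal_distribution (\<lambda>x. iexp (t * x))"
    by (rule integrable_iexp) auto
  then have 2: "integrable std_normal_distribution (\<lambda>x. Re (iexp (t * x)))"
    by (rule integrable_Re)
  have re: "Re (iexp (t * x)) = cos (t * x)" for x
    by (simp add: Re_exp)
  have "integrable lborel (\<lambda>x. std_normal_density x * cos (t * x))"
    using 2 unfolding re by (subst (asm) integrable_density) auto
  then have "integrable lborel (\<lambda>x. sqrt (2 * pi) * (std_normal_density x * cos (t * x)))"
    by (rule integrable_mult_right)
  moreover have eq: "(\<lambda>x. sqrt (2 * pi) * (std_normal_density x * cos (t * x))) = (\<lambda>x. exp (- x\<^sup>2 / 2) * cos (t * x))"
    by (simp add: d fun_eq_iff field_simps)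
  ultimately show ?I by simp
  have "(LINT x|std_normal_distribution. cos (t * x)) = Re (char std_normal_distribution t)"
    unfolding char_def using integral_Re[OF 1] unfolding re by simp
  also have "\<dots> = exp (- t\<^sup>2 / 2)"
    by (simp add: char_std_normal_distribution)
  finally have "(LINT x|lborel. std_normal_density x * cos (t * x)) = exp (- t\<^sup>2 / 2)"
    by (subst (asm) integral_density) auto
  then have "(LINT x|lborel. sqrt (2 * pi) * (std_normal_density x * cos (t * x))) = sqrt (2 * pi) * exp (- t\<^sup>2 / 2)"
    by simp
  then show ?E unfolding eq .
qed

lemma gaussian_cos_integral:
  assumes c: "c > 0"
  shows "integrable lborel (\<lambda>x. exp (- (c * x\<^sup>2)) * cos (w * x))" (is ?I)
    "(LINT x|lborel. exp (- (c * x\<^sup>2)) * cos (w * x)) = sqrt (pi / c) * exp (- w\<^sup>2 / (4 * c))" (is ?E)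
proof -
  define r where "r = sqrt (2 * c)"
  have r: "r > 0" "r\<^sup>2 = 2 * c"
    using c by (auto simp: r_def)
  have eq: "(\<lambda>x. exp (- (0 + r * x)\<^sup>2 / 2) * cos (w / r * (0 + r * x))) = (\<lambda>x. exp (- (c * x\<^sup>2)) * cos (w * x))"
    using r by (simp add: power_mult_distrib)
  show ?I
    using lborel_integrable_real_affine[OF gaussian_cos_integral_std(1)[of "w / r"], of r 0] r unfolding eq by simp
  have "sqrt (2 * pi) * exp (- (w / r)\<^sup>2 / 2) = r * (LINT x|lborel. exp (- (c * x\<^sup>2)) * cos (w * x))"
    using lborel_integral_real_affine[of r "\<lambda>x. exp (- x\<^sup>2 / 2) * cos (w / r * x)" 0] r
    unfolding eq gaussian_cos_integral_std(2) by simp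
  moreover have "sqrt (2 * pi) = r * sqrt (pi / c)"
    using c by (simp add: r_def flip: real_sqrt_mult)
  moreover have "(w / r)\<^sup>2 / 2 = w\<^sup>2 / (4 * c)"
    using r by (simp add: power_divide)
  ultimately show ?E
    using r by simp
qed

lemma gaussian_cos_integral_limit:
  assumes c: "c > 0"
  shows "(\<lambda>N. integral {- real N..real N} (\<lambda>x. exp (- (c * x\<^sup>2)) * cos (w * x)))
    \<longlonglongrightarrow> sqrt (pi / c) * exp (- w\<^sup>2 / (4 * c))"
proof -
  define f where "f x = exp (- (c * x\<^sup>2)) * cos (w * x)" for x
  have U: "(\<Union>N. {- real N..real N}) = UNIV"
  proof -
    have "\<exists>N. x \<in> {- real N..real N}" for x
      using real_arch_simple[of "\<bar>x\<bar>"] by (auto simp: abs_le_iff minus_le_iff)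
    then show ?thesis by blast
  qed
  have "(\<lambda>N. LINT x:{- real N..real N}|lborel. f x) \<longlonglongrightarrow> (LINT x:(\<Union>N. {- real N..real N})|lborel. f x)"
    using gaussian_cos_integral(1)[OF c, of w]
    by (intro set_integral_cont_up) (auto simp: incseq_def U set_integrable_def f_def[abs_def])
  moreover have "(LINT x:{- real N..real N}|lborel. f x) = integral {- real N..real N} f" for N
    by (intro set_borel_integral_eq_integral borel_integrable_atLeastAtMost')
       (auto intro!: continuous_intros simp: f_def[abs_def])
  ultimately show ?thesis
    using gaussian_cos_integral(2)[OF c, of w] by (simp add: U set_lebesgue_integral_def f_def[abs_def])
qed

text \<open>Fourier uniqueness for functions symmetric about 1/2. Such a \<open>D\<close> is a
  continuous function \<open>E\<close> of cos (2 pi z), hence a uniform limit of polynomials in that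
  cosine; all of these are orthogonal to \<open>D\<close>, so the integral of the square of
  \<open>D\<close> vanishes.\<close>

lemma cos_moments_zero_imp_zero:
  fixes D :: "real \<Rightarrow> real"
  assumes cont: "continuous_on {0..1} D"
    and sym: "\<And>z. z \<in> {0..1} \<Longrightarrow> D (1 - z) = D z"
    and mom: "\<And>k::int. integral {0..1} (\<lambda>z. D z * cos (2 * pi * of_int k * z)) = 0"
    and z: "z \<in> {0..1}"
  shows "D z = 0"
proof -
  define x where "x z = cos (2 * pi * z)" for z :: real
  have contx: "continuous_on S x" for S
    unfolding x_def by (intro continuous_intros)
  \<comment> \<open>The frequency k stays arbitrary in the induction: one more factor cos (2 pi z)
    replaces k by the mean of the cases k + 1 and k - 1.\<close>
  have moment: "integral {0..1} (\<lambda>z. D z * x z ^ n * cos (2 * pi * of_int k * z)) = 0" for n and k :: int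
  proof (induction n arbitrary: k)
    case 0
    then show ?case using mom[of k] by simp
  next
    case (Suc n)
    let ?g = "\<lambda>(k::int) z. D z * x z ^ n * cos (2 * pi * of_int k * z)"
    have int: "?g k integrable_on {0..1}" for k
      by (intro integrable_continuous_interval continuous_intros cont contx)
    have "cos (2 * pi * z) * cos (2 * pi * of_int k * z) =
        cos (2 * pi * of_int (k + 1) * z) / 2 + cos (2 * pi * of_int (k - 1) * z) / 2" for z
      by (simp add: cos_times_cos algebra_simps add_divide_distrib) (simp add: cos_diff)
    then have "D z * x z ^ n * (x z * cos (2 * pi * of_int k * z)) = ?g (k + 1) z / 2 + ?g (k - 1) z / 2" for z
      by (simp only: x_def distrib_left times_divide_eq_right)
    then have "D z * x z ^ Suc n * cos (2 * pi * of_int k * z) = ?g (k + 1) z / 2 + ?g (k - 1) z / 2" for z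
      by (simp only: power_Suc2 mult.assoc)
    then have "integral {0..1} (\<lambda>z. D z * x z ^ Suc n * cos (2 * pi * of_int k * z)) =
        integral {0..1} (\<lambda>z. ?g (k + 1) z / 2 + ?g (k - 1) z / 2)"
      by (simp only:)
    also have "\<dots> = integral {0..1} (\<lambda>z. ?g (k + 1) z / 2) + integral {0..1} (\<lambda>z. ?g (k - 1) z / 2)"
      by (intro integral_add integrable_on_divide int)
    also have "\<dots> = 0"
      unfolding integral_divide Suc.IH by simp
    finally show ?case .
  qed
  \<comment> \<open>\<open>arccos\<close> inverts the cosine only for z <= 1/2; the other half of
    the interval is reached through the symmetry of \<open>D\<close>.\<close>
  define E where "E u = D (arccos u / (2 * pi))" for u
  have "continuous_on {-1..1} E"
    unfolding E_def
  proof (rule continuous_on_compose2[OF cont])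
    show "continuous_on {-1..1} (\<lambda>u. arccos u / (2 * pi))"
      by (intro continuous_intros) auto
    show "(\<lambda>u. arccos u / (2 * pi)) ` {-1..1} \<subseteq> {0..1}"
      using arccos_lbound arccos_ubound pi_gt_zero by (fastforce simp: field_simps)
  qed
  moreover have DE: "D z = E (x z)" if z: "z \<in> {0..1}" for z
  proof (cases "z \<le> 1 / 2")
    case True
    then have "2 * pi * z \<le> pi" "0 \<le> 2 * pi * z"
      using z mult_left_mono[OF True, of "2 * pi"] by auto
    then have "arccos (x z) = 2 * pi * z"
      unfolding x_def by (intro arccos_cos)
    then show ?thesis by (simp add: E_def)
  next
    case False
    then have "1 - z \<le> 1 / 2" by simp
    then have "2 * pi * (1 - z) \<le> pi" "0 \<le> 2 * pi * (1 - z)"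
      using z mult_left_mono[of "1 - z" "1 / 2" "2 * pi"] by auto
    then have "arccos (cos (2 * pi * (1 - z))) = 2 * pi * (1 - z)"
      by (intro arccos_cos)
    moreover have "cos (2 * pi * (1 - z)) = x z"
      by (simp add: x_def right_diff_distrib cos_diff)
    ultimately have "arccos (x z) / (2 * pi) = 1 - z"
      by simp
    then show ?thesis using sym[OF z] by (simp add: E_def)
  qed
  have bound: "integral {0..1} (\<lambda>z. (D z)\<^sup>2) \<le> e * integral {0..1} (\<lambda>z. \<bar>D z\<bar>)" if e: "e > 0" for e
  proof -
    obtain g where g: "real_polynomial_function g" "\<And>u. u \<in> {-1..1} \<Longrightarrow> \<bar>E u - g u\<bar> < e"
      using Stone_Weierstrass_real_polynomial_function[OF compact_Icc \<open>continuous_on {-1..1} E\<close> e] by blast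
    then obtain a n where a: "g = (\<lambda>u. \<Sum>i\<le>n. a i * u ^ i)"
      using real_polynomial_function_iff_sum by blast
    have gc: "continuous_on {0..1} (\<lambda>z. g (x z))"
      unfolding a by (intro continuous_intros cont contx)
    have Ig: "integral {0..1} (\<lambda>z. D z * g (x z)) = 0"
    proof -
      have "integral {0..1} (\<lambda>z. D z * g (x z)) = integral {0..1} (\<lambda>z. \<Sum>i\<le>n. a i * (D z * x z ^ i))"
        by (simp add: a sum_distrib_left mult_ac)
      also have "\<dots> = (\<Sum>i\<le>n. integral {0..1} (\<lambda>z. a i * (D z * x z ^ i)))"
        by (intro integral_sum integrable_continuous_interval continuous_intros cont contx) auto
      also have "\<dots> = 0"
        using moment[of _ 0] by simp
      finally show ?thesis .
    qed
    have "integral {0..1} (\<lambda>z. (D z)\<^sup>2) = integral {0..1} (\<lambda>z. (D z)\<^sup>2) - integral {0..1} (\<lambda>z. D z * g (x z))"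
      by (simp add: Ig)
    also have "\<dots> = integral {0..1} (\<lambda>z. (D z)\<^sup>2 - D z * g (x z))"
      by (intro integral_diff[symmetric] integrable_continuous_interval continuous_intros cont gc)
    also have "\<dots> \<le> integral {0..1} (\<lambda>z. e * \<bar>D z\<bar>)"
    proof (intro integral_le integrable_continuous_interval continuous_intros cont gc)
      fix z :: real assume z: "z \<in> {0..1}"
      have "(D z)\<^sup>2 - D z * g (x z) = D z * (E (x z) - g (x z))"
        by (simp add: DE[OF z] power2_eq_square algebra_simps)
      also have "\<dots> \<le> \<bar>D z\<bar> * \<bar>E (x z) - g (x z)\<bar>"
        by (simp flip: abs_mult)
      also have "\<dots> \<le> \<bar>D z\<bar> * e"
        using g(2)[of "x z"] by (intro mult_left_mono) (auto simp: x_def)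
      finally show "(D z)\<^sup>2 - D z * g (x z) \<le> e * \<bar>D z\<bar>"
        by (simp add: mult.commute)
    qed
    finally show ?thesis by simp
  qed
  define J where "J = integral {0..1} (\<lambda>z. \<bar>D z\<bar>)"
  have "J \<ge> 0"
    unfolding J_def by (intro integral_nonneg integrable_continuous_interval continuous_intros cont) auto
  have "integral {0..1} (\<lambda>z. (D z)\<^sup>2) \<le> 0 + e" if "e > 0" for e
  proof -
    \<comment> \<open>The denominator J + 1 stays positive when J = 0.\<close>
    have "integral {0..1} (\<lambda>z. (D z)\<^sup>2) \<le> e / (J + 1) * J"
      unfolding J_def using bound[of "e / (J + 1)"] that \<open>J \<ge> 0\<close> by (simp add: J_def)
    also have "\<dots> \<le> e"
      using that \<open>J \<ge> 0\<close> by (simp add: field_simps)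
    finally show ?thesis by simp
  qed
  then have "integral {0..1} (\<lambda>z. (D z)\<^sup>2) \<le> 0"
    by (rule field_le_epsilon)
  moreover have "integral {0..1} (\<lambda>z. (D z)\<^sup>2) \<ge> 0"
    by (intro integral_nonneg integrable_continuous_interval continuous_intros cont) auto
  ultimately have "integral {0..1} (\<lambda>z. (D z)\<^sup>2) = 0"
    by simp
  moreover have "continuous_on {0..1} (\<lambda>z. (D z)\<^sup>2)"
    by (intro continuous_intros cont)
  ultimately show ?thesis
    using integral_eq_0_iff[of 0 1 "\<lambda>z. (D z)\<^sup>2"] z by auto
qed

text \<open>The M-test gives uniform convergence along the filter of finite subsets, which preserves
  continuity and permits termwise integration.\<close>

lemma has_sum_integral_Weierstrass:
  fixes f :: "int \<Rightarrow> real \<Rightarrow> real"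
  assumes cont: "\<And>n. continuous_on {a..b} (f n)"
    and bound: "\<And>n z. z \<in> {a..b} \<Longrightarrow> \<bar>f n z\<bar> \<le> M n"
    and M: "M summable_on UNIV"
  shows "continuous_on {a..b} (\<lambda>z. \<Sum>\<^sub>\<infinity>n. f n z)"
    and "((\<lambda>n. integral {a..b} (f n)) has_sum integral {a..b} (\<lambda>z. \<Sum>\<^sub>\<infinity>n. f n z)) UNIV"
proof -
  have u: "uniform_limit {a..b} (\<lambda>X z. \<Sum>n\<in>X. f n z) (\<lambda>z. \<Sum>\<^sub>\<infinity>n. f n z) (finite_subsets_at_top UNIV)"
    using bound M by (intro Weierstrass_m_test_general) auto
  have c: "continuous_on {a..b} (\<lambda>z. \<Sum>n\<in>X. f n z)" for X
    by (intro continuous_intros cont)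
  show "continuous_on {a..b} (\<lambda>z. \<Sum>\<^sub>\<infinity>n. f n z)"
    by (rule uniform_limit_theorem[OF _ u]) (auto simp: c)
  obtain I J where IJ: "\<And>X. ((\<lambda>z. \<Sum>n\<in>X. f n z) has_integral I X) {a..b}"
    "((\<lambda>z. \<Sum>\<^sub>\<infinity>n. f n z) has_integral J) {a..b}" "(I \<longlongrightarrow> J) (finite_subsets_at_top UNIV)"
    using uniform_limit_integral[OF u c] by auto
  have "eventually (\<lambda>X. I X = (\<Sum>n\<in>X. integral {a..b} (f n))) (finite_subsets_at_top UNIV)"
  proof (rule eventually_finite_subsets_at_top_weakI)
    fix X :: "int set" assume "finite X"
    then have "integral {a..b} (\<lambda>z. \<Sum>n\<in>X. f n z) = (\<Sum>n\<in>X. integral {a..b} (f n))"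
      by (intro integral_sum integrable_continuous_interval cont)
    then show "I X = (\<Sum>n\<in>X. integral {a..b} (f n))"
      using IJ(1)[of X] by (simp add: integral_unique)
  qed
  then have "((\<lambda>X. \<Sum>n\<in>X. integral {a..b} (f n)) \<longlongrightarrow> J) (finite_subsets_at_top UNIV)"
    using IJ(3) by (simp add: tendsto_cong)
  then show "((\<lambda>n. integral {a..b} (f n)) has_sum integral {a..b} (\<lambda>z. \<Sum>\<^sub>\<infinity>n. f n z)) UNIV"
    using IJ(2) by (simp add: has_sum_def integral_unique)
qed

text \<open>The range is half-open so that the unit intervals [n, n+1] with n in it tile [-N, N]
  exactly.\<close>

lemma has_sum_int_imp_LIMSEQ:
  fixes f :: "int \<Rightarrow> 'a :: {comm_monoid_add, topological_space}"
  assumes "(f has_sum S) UNIV"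
  shows "(\<lambda>N. \<Sum>n\<in>{- int N..<int N}. f n) \<longlonglongrightarrow> S"
proof -
  have "filterlim (\<lambda>N. {- int N..<int N}) (finite_subsets_at_top UNIV) sequentially"
    unfolding filterlim_finite_subsets_at_top
  proof (intro allI impI)
    fix X :: "int set" assume X: "finite X \<and> X \<subseteq> UNIV"
    have "\<forall>\<^sub>F N in sequentially. n \<in> {- int N..<int N}" for n
      by (rule eventually_sequentiallyI[of "nat (\<bar>n\<bar> + 1)"]) auto
    then have "\<forall>\<^sub>F N in sequentially. \<forall>n\<in>X. n \<in> {- int N..<int N}"
      using X by (auto intro!: eventually_ball_finite)
    then show "\<forall>\<^sub>F N in sequentially. finite {- int N..<int N} \<and> X \<subseteq> {- int N..<int N} \<and> {- int N..<int N} \<subseteq> UNIV"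
      by eventually_elim auto
  qed
  then show ?thesis
    using assms unfolding has_sum_def by (rule filterlim_compose[rotated])
qed

section \<open>Fourier coefficients of cosine series and of Gaussian sums\<close>

lemma integral_cos_2pi_int: "integral {0..1} (\<lambda>z. cos (2 * pi * of_int k * z)) = (if k = 0 then 1 else 0)"
proof (cases "k = 0")
  case False
  have "((\<lambda>z. cos (2 * pi * of_int k * z)) has_integral
      sin (2 * pi * of_int k * 1) / (2 * pi * of_int k) - sin (2 * pi * of_int k * 0) / (2 * pi * of_int k)) {0..1}"
    by (rule fundamental_theorem_of_calculus)
       (use False in \<open>auto intro!: derivative_eq_intros simp flip: has_real_derivative_iff_has_vector_derivative\<close>)
  then show ?thesis
    using False sin_int_2pin[of k] by (simp add: integral_unique mult_ac)
qed auto

text \<open>After the product-to-sum formula only m = k and m = -k survive, each with half its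
  coefficient; for k = 0 the two halves fall on the same index.\<close>

lemma has_sum_integral_cos_series:
  fixes a :: "int \<Rightarrow> real"
  assumes a: "a summable_on UNIV" "\<And>m. a m \<ge> 0" "\<And>m. a (- m) = a m"
  shows "((\<lambda>m. integral {0..1} (\<lambda>z. a m * cos (2 * pi * of_int m * z) * cos (2 * pi * of_int k * z))) has_sum a k) UNIV"
proof -
  have int: "(\<lambda>z. cos (2 * pi * of_int m * z)) integrable_on {0..1}" for m :: int
    by (intro integrable_continuous_interval continuous_intros)
  have "integral {0..1} (\<lambda>z. a m * cos (2 * pi * of_int m * z) * cos (2 * pi * of_int k * z)) =
      (if m = k then a m / 2 else 0) + (if m = - k then a m / 2 else 0)" for m
  proof -
    have "a m * cos (2 * pi * of_int m * z) * cos (2 * pi * of_int k * z) =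
        a m / 2 * (cos (2 * pi * of_int (m - k) * z) + cos (2 * pi * of_int (m + k) * z))" for z
    proof -
      have "cos (2 * pi * of_int m * z) * cos (2 * pi * of_int k * z) =
          (cos (2 * pi * of_int (m - k) * z) + cos (2 * pi * of_int (m + k) * z)) / 2"
        unfolding cos_times_cos by (simp add: algebra_simps)
      then show ?thesis by (simp add: mult.assoc)
    qed
    then have "integral {0..1} (\<lambda>z. a m * cos (2 * pi * of_int m * z) * cos (2 * pi * of_int k * z)) =
       a m / 2 * (integral {0..1} (\<lambda>z. cos (2 * pi * of_int (m - k) * z)) + integral {0..1} (\<lambda>z. cos (2 * pi * of_int (m + k) * z)))"
      by (simp only: integral_mult_right integral_add[OF int int])
    then show ?thesis
      unfolding integral_cos_2pi_int right_minus_eq eq_neg_iff_add_eq_0 by (simp add: distrib_left)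
  qed
  moreover have "((\<lambda>m. (if m = k then a m / 2 else 0) + (if m = - k then a m / 2 else 0)) has_sum (a k / 2 + a (- k) / 2)) UNIV"
    by (intro has_sum_add; rule has_sum_finite_neutralI[of "{k}"] has_sum_finite_neutralI[of "{- k}"]) auto
  ultimately show ?thesis
    by (simp add: a(3))
qed

text \<open>Unfolding of the periodization: the cosine is 1-periodic, so the integrals of the
  summands over the unit interval join to the Fourier integral of one Gaussian over the real line,
  at frequency 2 pi k.\<close>

lemma gauss_sum_fourier_coefficient:
  assumes c: "c > 0"
  shows "continuous_on {0..1} (gauss_sum c)"
    and "integral {0..1} (\<lambda>z. gauss_sum c z * cos (2 * pi * of_int k * z)) = sqrt (pi / c) * exp (- (pi\<^sup>2 / c * (of_int k)\<^sup>2))"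
proof -
  define w where "w z = cos (2 * pi * of_int k * z)" for z :: real
  define f where "f n z = exp (- (c * (of_int n + z)\<^sup>2))" for n :: int and z
  define M where "M n = exp c * exp (- c / 2) ^ nat \<bar>n\<bar>" for n :: int
  have M: "M summable_on UNIV"
    unfolding M_def using c by (intro summable_on_cmult_right summable_on_power_abs_int) auto
  have fM: "\<bar>f n z\<bar> \<le> M n" if "z \<in> {0..1}" for n z
  proof -
    have "c * z\<^sup>2 \<le> c * 1"
      using that c by (intro mult_left_mono) (auto simp: power_le_one)
    then have "exp (c * z\<^sup>2) * exp (- c / 2) ^ nat \<bar>n\<bar> \<le> M n"
      unfolding M_def by (intro mult_right_mono) auto
    then show ?thesis
      using exp_square_shift_le[OF c, of n z] by (simp add: f_def)
  qed
  have fc: "continuous_on {0..1} (f n)" for n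
    unfolding f_def by (intro continuous_intros)
  have G: "gauss_sum c = (\<lambda>z. \<Sum>\<^sub>\<infinity>n. f n z)"
    by (simp add: gauss_sum_def f_def fun_eq_iff)
  show "continuous_on {0..1} (gauss_sum c)"
    unfolding G by (rule has_sum_integral_Weierstrass(1)[OF fc fM M])
  have "((\<lambda>n. integral {0..1} (\<lambda>z. f n z * w z)) has_sum integral {0..1} (\<lambda>z. \<Sum>\<^sub>\<infinity>n. f n z * w z)) UNIV"
  proof (rule has_sum_integral_Weierstrass(2)[OF _ _ M])
    show "continuous_on {0..1} (\<lambda>z. f n z * w z)" for n
      unfolding w_def by (intro continuous_intros fc)
    show "\<bar>f n z * w z\<bar> \<le> M n" if "z \<in> {0..1}" for n z
      using mult_mono[OF fM[OF that, of n], of "\<bar>w z\<bar>" 1] by (simp add: abs_mult w_def M_def)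
  qed
  then have "((\<lambda>n. integral {0..1} (\<lambda>z. f n z * w z)) has_sum integral {0..1} (\<lambda>z. gauss_sum c z * w z)) UNIV"
    by (simp add: G infsum_cmult_left')
  then have lim: "(\<lambda>N. \<Sum>n\<in>{- int N..<int N}. integral {0..1} (\<lambda>z. f n z * w z)) \<longlonglongrightarrow> integral {0..1} (\<lambda>z. gauss_sum c z * w z)"
    by (rule has_sum_int_imp_LIMSEQ)
  define h where "h x = exp (- (c * x\<^sup>2)) * cos (2 * pi * of_int k * x)" for x
  have hc: "continuous_on S h" for S
    unfolding h_def by (intro continuous_intros)
  then have hint: "h integrable_on {a..b}" for a b
    by (intro integrable_continuous_interval)
  have piece: "integral {0..1} (\<lambda>z. f n z * w z) = integral {of_int n..of_int n + 1} h" for n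
  proof -
    have "f n z * w z = h (z + of_int n)" for z
    proof -
      have "cos (2 * pi * of_int k * (z + of_int n)) = cos (2 * pi * of_int k * z + 2 * pi * of_int (k * n))"
        by (simp add: algebra_simps)
      also have "\<dots> = cos (2 * pi * of_int k * z)"
        using cos_int_2pin[of "k * n"] sin_int_2pin[of "k * n"] by (simp add: cos_add)
      finally show ?thesis
        by (simp add: f_def w_def h_def add.commute)
    qed
    then show ?thesis
      using integral_shift[of 0 "of_int n" 1 h] hc by (simp add: o_def add.commute)
  qed
  have "(\<Sum>n\<in>{- int N..<int N}. integral {0..1} (\<lambda>z. f n z * w z)) = integral {- real N..real N} h" for N
  proof (induction N)
    case (Suc N)
    have "{- int (Suc N)..<int (Suc N)} = insert (- int N - 1) (insert (int N) {- int N..<int N})"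
      by auto
    then have "(\<Sum>n\<in>{- int (Suc N)..<int (Suc N)}. integral {0..1} (\<lambda>z. f n z * w z)) =
        integral {- real N - 1..- real N} h + (integral {real N..real N + 1} h + integral {- real N..real N} h)"
      by (simp only: piece Suc.IH[unfolded piece]) (simp add: Suc.IH[unfolded piece])
    also have "\<dots> = integral {- real N - 1..- real N} h + integral {- real N..real N + 1} h"
      using Henstock_Kurzweil_Integration.integral_combine[of "- real N" "real N" "real N + 1" h] hint by simp
    also have "\<dots> = integral {- real N - 1..real N + 1} h"
      using Henstock_Kurzweil_Integration.integral_combine[of "- real N - 1" "- real N" "real N + 1" h] hint by simp
    also have "{- real N - 1..real N + 1} = {- real (Suc N)..real (Suc N)}"
      by simp
    finally show ?case .
  qed simp
  then have "(\<lambda>N. integral {- real N..real N} h) \<longlonglongrightarrow> integral {0..1} (\<lambda>z. gauss_sum c z * w z)"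
    using lim by simp
  moreover have "(\<lambda>N. integral {- real N..real N} h) \<longlonglongrightarrow> sqrt (pi / c) * exp (- (2 * pi * of_int k)\<^sup>2 / (4 * c))"
    unfolding h_def by (rule gaussian_cos_integral_limit[OF c])
  ultimately have "integral {0..1} (\<lambda>z. gauss_sum c z * w z) = sqrt (pi / c) * exp (- (2 * pi * of_int k)\<^sup>2 / (4 * c))"
    by (rule LIMSEQ_unique)
  then show "integral {0..1} (\<lambda>z. gauss_sum c z * cos (2 * pi * of_int k * z)) = sqrt (pi / c) * exp (- (pi\<^sup>2 / c * (of_int k)\<^sup>2))"
    by (simp add: w_def power_mult_distrib)
qed

lemma summable_on_gauss_cos:
  assumes "d > 0"
  shows "(\<lambda>m::int. exp (- (d * (of_int m)\<^sup>2)) * cos (2 * pi * of_int m * z)) summable_on UNIV"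
proof -
  have "(\<lambda>m::int. norm (exp (- (d * (of_int m)\<^sup>2)) * cos (2 * pi * of_int m * z))) summable_on UNIV"
    by (rule summable_on_comparison_test[OF summable_on_gauss[OF assms, of 0]])
       (auto simp: abs_mult intro: mult_left_le)
  then show ?thesis
    by (rule abs_summable_summable)
qed

text \<open>Both sides are continuous on [0,1], symmetric under z -> 1 - z and have the same cosine
  coefficients, so \<open>cos_moments_zero_imp_zero\<close> applies to their difference.\<close>

lemma gauss_sum_poisson:
  assumes c: "c > 0" and z: "z \<in> {0..1}"
  shows "gauss_sum c z = sqrt (pi / c) * (\<Sum>\<^sub>\<infinity>m\<in>(UNIV :: int set). exp (- (pi\<^sup>2 / c * (of_int m)\<^sup>2)) * cos (2 * pi * of_int m * z))"
proof -
  define d where "d = pi\<^sup>2 / c"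
  have d: "d > 0" using c by (simp add: d_def)
  define a where "a m = sqrt (pi / c) * exp (- (d * (of_int m)\<^sup>2))" for m :: int
  have "(\<lambda>m::int. exp (- (d * (of_int m)\<^sup>2))) summable_on UNIV"
    using summable_on_gauss[OF d, of 0] by simp
  then have a: "a summable_on UNIV" "a m \<ge> 0" "a (- m) = a m" for m
    using c by (auto simp: a_def[abs_def] intro!: summable_on_cmult_right)
  define H where "H z = (\<Sum>\<^sub>\<infinity>m. a m * cos (2 * pi * of_int m * z))" for z
  have bound: "\<bar>a m * cos (2 * pi * of_int m * z)\<bar> \<le> a m" for m z
    using a(2)[of m] by (simp add: abs_mult mult_left_le)
  have Hc: "continuous_on {0..1} H"
    unfolding H_def by (rule has_sum_integral_Weierstrass(1)[OF _ bound a(1)]) (intro continuous_intros)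
  have HI: "integral {0..1} (\<lambda>z. H z * cos (2 * pi * of_int k * z)) = a k" for k :: int
  proof -
    have "\<bar>a m * cos (2 * pi * of_int m * z) * cos (2 * pi * of_int k * z)\<bar> \<le> a m" for m z
      using mult_mono[OF bound[of m z], of "\<bar>cos (2 * pi * of_int k * z)\<bar>" 1] a(2)[of m] by (simp add: abs_mult)
    then have "((\<lambda>m. integral {0..1} (\<lambda>z. a m * cos (2 * pi * of_int m * z) * cos (2 * pi * of_int k * z))) has_sum
      integral {0..1} (\<lambda>z. \<Sum>\<^sub>\<infinity>m. a m * cos (2 * pi * of_int m * z) * cos (2 * pi * of_int k * z))) UNIV"
      by (intro has_sum_integral_Weierstrass(2)[OF _ _ a(1)] continuous_intros)
    then have "((\<lambda>m. integral {0..1} (\<lambda>z. a m * cos (2 * pi * of_int m * z) * cos (2 * pi * of_int k * z))) has_sum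
      integral {0..1} (\<lambda>z. H z * cos (2 * pi * of_int k * z))) UNIV"
      by (simp only: H_def infsum_cmult_left')
    then show ?thesis
      using has_sum_integral_cos_series[OF a, of k] by (rule has_sum_unique)
  qed
  have gI: "integral {0..1} (\<lambda>z. gauss_sum c z * cos (2 * pi * of_int k * z)) = a k" for k :: int
    using gauss_sum_fourier_coefficient(2)[OF c, of k] by (simp add: a_def d_def)
  note gc = gauss_sum_fourier_coefficient(1)[OF c]
  have "gauss_sum c z - H z = 0"
  proof (rule cos_moments_zero_imp_zero[OF _ _ _ z])
    show "continuous_on {0..1} (\<lambda>z. gauss_sum c z - H z)"
      by (intro continuous_intros gc Hc)
    show "gauss_sum c (1 - z) - H (1 - z) = gauss_sum c z - H z" for z
    proof -
      have "gauss_sum c (1 - z) = gauss_sum c z"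
        using gauss_sum_add_int[of c "- z" 1] gauss_sum_uminus[of c z] by simp
      moreover have "cos (2 * pi * of_int m * (1 - z)) = cos (2 * pi * of_int m * z)" for m :: int
        using cos_int_2pin[of m] sin_int_2pin[of m] by (simp only: right_diff_distrib cos_diff) simp
      ultimately show ?thesis by (simp add: H_def)
    qed
    show "integral {0..1} (\<lambda>z. (gauss_sum c z - H z) * cos (2 * pi * of_int k * z)) = 0" for k :: int
    proof -
      have "integral {0..1} (\<lambda>z. gauss_sum c z * cos (2 * pi * of_int k * z) - H z * cos (2 * pi * of_int k * z)) =
        integral {0..1} (\<lambda>z. gauss_sum c z * cos (2 * pi * of_int k * z)) - integral {0..1} (\<lambda>z. H z * cos (2 * pi * of_int k * z))"
        by (intro integral_diff integrable_continuous_interval continuous_intros gc Hc)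
      then show ?thesis
        by (simp add: left_diff_distrib gI HI)
    qed
  qed
  then show ?thesis
    by (simp add: H_def a_def d_def infsum_cmult_right' mult.assoc)
qed

lemma gauss_sum_inversion:
  assumes "c > 0"
  shows "gauss_sum c 0 = sqrt (pi / c) * gauss_sum (pi\<^sup>2 / c) 0"
  using gauss_sum_poisson[OF assms, of 0] by (simp add: gauss_sum_def)

section \<open>The ninth division values\<close>

lemma has_sum_geometric_even_tail:
  fixes y :: real
  assumes "0 \<le> y" "y < 1"
  shows "((\<lambda>m::int. (y\<^sup>2) ^ nat \<bar>m\<bar>) has_sum (2 * (y ^ 4 / (1 - y\<^sup>2)))) ({2..} \<union> {..-2})"
proof -
  have "y\<^sup>2 < 1"
    using assms by (simp add: power_less_one_iff)
  then have "((\<lambda>n. (y\<^sup>2) ^ n) has_sum (1 / (1 - y\<^sup>2))) UNIV"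
    by (intro sums_nonneg_imp_has_sum geometric_sums) auto
  then have n: "((\<lambda>n. (y\<^sup>2) ^ (n + 2)) has_sum (y ^ 4 / (1 - y\<^sup>2))) UNIV"
    using has_sum_cmult_right[of "\<lambda>n. (y\<^sup>2) ^ n" UNIV "1 / (1 - y\<^sup>2)" "y ^ 4"]
    by (simp add: power_add mult.commute flip: power_mult)
  have shift: "y ^ 4 * (y\<^sup>2) ^ (k - 2) = (y\<^sup>2) ^ k" if "2 \<le> k" for k
  proof -
    have "y ^ 4 = (y\<^sup>2) ^ 2"
      by simp
    then have "y ^ 4 * (y\<^sup>2) ^ (k - 2) = (y\<^sup>2) ^ (2 + (k - 2))"
      by (simp only: power_add)
    also have "2 + (k - 2) = k"
      using that by simp
    finally show ?thesis .
  qed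
  have 1: "((\<lambda>m::int. (y\<^sup>2) ^ nat \<bar>m\<bar>) has_sum (y ^ 4 / (1 - y\<^sup>2))) {2..}"
    by (rule iffD2[OF has_sum_reindex_bij_witness[of _ "\<lambda>n. int n + 2" "\<lambda>m. nat (m - 2)"] n])
       (auto simp: nat_diff_distrib nat_add_distrib shift)
  have 2: "((\<lambda>m::int. (y\<^sup>2) ^ nat \<bar>m\<bar>) has_sum (y ^ 4 / (1 - y\<^sup>2))) {..-2}"
    by (rule iffD2[OF has_sum_reindex_bij_witness[of _ "\<lambda>n. - int n - 2" "\<lambda>m. nat (- m - 2)"] n])
       (auto simp: nat_diff_distrib nat_add_distrib shift)
  have "{2..} \<inter> {..-2::int} = {}"
    by auto
  then show ?thesis
    using has_sum_Un_disjoint[OF 1 2] by simp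
qed

text \<open>The terms m = -1, 0, 1 are kept. For |m| >= 2 one has m^2 >= 2 |m|, so the rest lies
  below a geometric tail in y^2.\<close>

lemma gauss_cos_sum_approx:
  fixes d z :: real
  assumes d: "d > 0" and y: "y = exp (- d)"
  shows "\<bar>(\<Sum>\<^sub>\<infinity>m\<in>(UNIV :: int set). exp (- (d * (of_int m)\<^sup>2)) * cos (2 * pi * of_int m * z)) - (1 + 2 * y * cos (2 * pi * z))\<bar>
    \<le> 2 * (y ^ 4 / (1 - y\<^sup>2))"
proof -
  define f where "f m = exp (- (d * (of_int m)\<^sup>2)) * cos (2 * pi * of_int m * z)" for m :: int
  define T where "T = {2..} \<union> {..-2::int}"
  have y01: "0 \<le> y" "y < 1"
    using d y by auto
  have fs: "f summable_on S" for S
    unfolding f_def by (rule summable_on_subset_banach[OF summable_on_gauss_cos[OF d]]) simp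
  have "UNIV = {-1, 0, 1} \<union> T"
    by (auto simp: T_def)
  then have "infsum f UNIV = infsum f {-1, 0, 1} + infsum f T"
    using infsum_Un_disjoint[OF fs fs, of "{-1, 0, 1}" T] by (auto simp: T_def)
  also have "infsum f {-1, 0, 1} = 1 + 2 * y * cos (2 * pi * z)"
    by (simp add: f_def y)
  finally have "infsum f UNIV - (1 + 2 * y * cos (2 * pi * z)) = infsum f T"
    by simp
  moreover have "norm (infsum f T) \<le> 2 * (y ^ 4 / (1 - y\<^sup>2))"
  proof (rule norm_infsum_le[OF has_sum_infsum[OF fs] has_sum_geometric_even_tail[OF y01, folded T_def]])
    fix m assume "m \<in> T"
    then have "2 * \<bar>m\<bar> \<le> \<bar>m\<bar> * \<bar>m\<bar>"
      by (intro mult_right_mono) (auto simp: T_def)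
    then have "2 * nat \<bar>m\<bar> \<le> nat (m\<^sup>2)"
      by (simp add: power2_eq_square nat_mult_distrib abs_mult[symmetric] nat_le_iff)
    have "norm (f m) \<le> exp (- (d * (of_int m)\<^sup>2))"
      unfolding f_def by (auto simp: abs_mult intro: mult_left_le)
    also have "\<dots> = y ^ nat (m\<^sup>2)"
      by (simp add: y mult.commute flip: exp_of_nat_mult)
    also have "\<dots> \<le> y ^ (2 * nat \<bar>m\<bar>)"
      using \<open>2 * nat \<bar>m\<bar> \<le> nat (m\<^sup>2)\<close> y01 by (intro power_decreasing) auto
    finally show "norm (f m) \<le> (y\<^sup>2) ^ nat \<bar>m\<bar>"
      by (simp add: power_mult)
  qed
  ultimately show ?thesis
    by (simp add: f_def[abs_def])
qed

text \<open>The three numbers are the roots of t^3 - 3 t + 1, permuted cyclically by angle doubling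
  t -> t^2 - 2.\<close>

lemma cos_ninths:
  fixes k :: "nat \<Rightarrow> real"
  defines "k j \<equiv> 2 * cos (2 * pi * real j / 9)"
  shows "k 2 = (k 1)\<^sup>2 - 2" "k 4 = (k 2)\<^sup>2 - 2" "k 1 = (k 4)\<^sup>2 - 2"
    "k 1 + k 2 + k 4 = 0" "k 1 * k 2 + k 2 * k 4 + k 4 * k 1 = -3" "k 1 * k 2 * k 4 = -1"
    "1 < k 1" "1/3 < k 2" "k 2 < 1" "k 4 < 0" "-2 \<le> k 4"
proof -
  have dbl: "2 * cos (2 * x) = (2 * cos x)\<^sup>2 - 2" for x :: real
    by (simp add: cos_double_cos power_mult_distrib)
  show 2: "k 2 = (k 1)\<^sup>2 - 2" and 4: "k 4 = (k 2)\<^sup>2 - 2"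
    using dbl[of "2 * pi / 9"] dbl[of "4 * pi / 9"] by (simp_all add: k_def mult_ac)
  have "cos (16 * pi / 9) = cos (2 * pi / 9)"
    using cos_diff[of "2 * pi" "2 * pi / 9"] by simp
  then show 1: "k 1 = (k 4)\<^sup>2 - 2"
    using dbl[of "8 * pi / 9"] by (simp add: k_def mult_ac)
  have "cos (2 * pi / 9) + cos (4 * pi / 9) = 2 * cos (pi / 3) * cos (pi / 9)"
    unfolding cos_plus_cos by (simp add: field_simps cos_minus[of "pi / 9", symmetric] del: cos_minus)
  also have "\<dots> = - cos (8 * pi / 9)"
    using cos_diff[of pi "pi / 9"] by (simp add: cos_60)
  finally show sum: "k 1 + k 2 + k 4 = 0"
    by (simp add: k_def mult_ac)
  \<comment> \<open>By the doubling relations the squares add up to the sum of the three numbers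
    plus 6.\<close>
  have "(k 1 + k 2 + k 4)\<^sup>2 = (k 1)\<^sup>2 + (k 2)\<^sup>2 + (k 4)\<^sup>2 + 2 * (k 1 * k 2 + k 2 * k 4 + k 4 * k 1)"
    by (simp add: power2_eq_square algebra_simps)
  then show e2: "k 1 * k 2 + k 2 * k 4 + k 4 * k 1 = -3"
    using 1 2 4 sum by simp
  have "cos (pi / 3) < cos (2 * pi / 9)"
    by (rule cos_monotone_0_pi) auto
  then show k1: "1 < k 1"
    by (simp add: k_def cos_60)
  have "cos (4 * pi / 9) < cos (pi / 3)"
    by (rule cos_monotone_0_pi) auto
  then show k2: "k 2 < 1"
    by (simp add: k_def cos_60 mult_ac)
  have "0 < cos (4 * pi / 9)"
    by (rule cos_gt_zero) auto
  then have k20: "0 < k 2"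
    by (simp add: k_def mult_ac)
  show "k 4 < 0" using sum k1 k20 by simp
  show "-2 \<le> k 4" by (simp add: k_def)
  have k4: "k 4 = - k 1 - k 2"
    using sum by simp
  \<comment> \<open>Eliminating \<open>k 2\<close> and \<open>k 4\<close> from the doubling
    relations and the zero sum leaves a quartic in \<open>k 1\<close> with the factor
    \<open>k 1\<close>.\<close>
  have cubic: "k 1 * (k 1)\<^sup>2 - 3 * k 1 + 1 = 0"
  proof -
    have "k 1 * (k 1 * (k 1)\<^sup>2 - 3 * k 1 + 1) = 0"
      using 4[unfolded k4, unfolded 2] by (simp add: power2_eq_square algebra_simps)
    then show ?thesis using k1 by simp
  qed
  have "k 2 * k 4 = -3 - k 1 * (k 2 + k 4)"
    using e2 by (simp add: algebra_simps)
  also have "k 2 + k 4 = - k 1"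
    using sum by simp
  finally have k24: "k 2 * k 4 = -3 + (k 1)\<^sup>2"
    by (simp add: power2_eq_square)
  then show e3: "k 1 * k 2 * k 4 = -1"
    unfolding mult.assoc k24 using cubic by (simp add: algebra_simps)
  have "k 4 * k 1 = -3 - k 2 * (k 1 + k 4)"
    using e2 by (simp add: algebra_simps)
  also have "k 1 + k 4 = - k 2"
    using sum by simp
  finally have k41: "k 4 * k 1 = -3 + (k 2)\<^sup>2"
    by (simp add: power2_eq_square)
  have "k 2 * (k 4 * k 1) = -1"
    using e3 by (simp add: mult_ac)
  then have "k 2 * (-3 + (k 2)\<^sup>2) = -1"
    unfolding k41 .
  \<comment> \<open>The previous equation reads 3 t = 1 + t^3 for t = \<open>k 2\<close>, and t^3 is
    positive.\<close>
  moreover have "0 < k 2 * (k 2)\<^sup>2"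
    using k20 by simp
  ultimately show "1/3 < k 2"
    by (simp add: algebra_simps)
qed

text \<open>Bounds the nome of the dual series, so that its terms with |m| <= 1 suffice to order the
  theta values. The constant 12/7 comes from pi > 3 and sqrt 3 < 7/4.\<close>

lemma exp_neg_pi_div_sqrt3_less: "exp (- (pi / sqrt 3)) < 1/3"
proof -
  have "sqrt 3 < 7/4"
    by (rule real_less_lsqrt) (auto simp: power2_eq_square)
  then have "12/7 < pi / sqrt 3"
    using pi_gt3 by (simp add: field_simps)
  then have "exp (12/7) < exp (pi / sqrt 3)"
    by simp
  moreover have "(1 + (12/7) / real 2) ^ 2 \<le> exp (12/7)"
    by (rule exp_ge_one_plus_x_over_n_power_n) auto
  moreover have "3 < (1 + (12/7) / real 2) ^ 2"
    by (simp add: power2_eq_square)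
  ultimately have "3 < exp (pi / sqrt 3)"
    by linarith
  then show ?thesis
    by (simp add: exp_minus field_simps)
qed


text \<open>Equal elementary symmetric functions mean the same cubic, hence the same set of roots;
  the ordering fixes the matching.\<close>

lemma sorted_roots_unique:
  fixes a b c x y z :: real
  assumes "a > b" "b > c" "x > y" "y > z"
    and 1: "a + b + c = x + y + z" and 2: "a * b + b * c + c * a = x * y + y * z + z * x" and 3: "a * b * c = x * y * z"
  shows "a = x \<and> b = y \<and> c = z"
proof -
  have root: "t = x \<or> t = y \<or> t = z" if "(t - a) * (t - b) * (t - c) = 0" for t
  proof -
    have "(t - a) * (t - b) * (t - c) = t ^ 3 - (a + b + c) * t\<^sup>2 + (a * b + b * c + c * a) * t - a * b * c"
      by (simp add: power2_eq_square power3_eq_cube algebra_simps)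
    also have "\<dots> = (t - x) * (t - y) * (t - z)"
      unfolding 1 2 3 by (simp add: power2_eq_square power3_eq_cube algebra_simps)
    finally have "(t - x) * (t - y) * (t - z) = 0"
      using that by simp
    then show ?thesis
      by simp
  qed
  have "a = x \<or> a = y \<or> a = z" "b = x \<or> b = y \<or> b = z" "c = x \<or> c = y \<or> c = z"
    by (rule root, simp)+
  then show ?thesis
    using assms(1-4) by (smt (verit))
qed

definition theta9 :: "nat \<Rightarrow> real" where
  "theta9 j = gauss_sum (pi * sqrt 3) (real j / 9)"

lemma theta9_pos: "theta9 j > 0"
  unfolding theta9_def by (rule gauss_sum_pos) simp

text \<open>Multiplied by \<open>theta9 1\<close> and \<open>theta9 4\<close> respectively, these
  order the three products that form the roots of the cubic. In the dual series,
  \<open>theta9 j\<close> is proportional to 1 + 2 y cos (2 pi j / 9) up to a small error.\<close>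

lemma theta9_order:
  "theta9 1 * theta9 4 < (theta9 2)\<^sup>2" "theta9 2 * theta9 4 < (theta9 1)\<^sup>2"
proof -
  define y where "y = exp (- (pi / sqrt 3))"
  have y: "0 < y" "y < 1/3"
    using exp_neg_pi_div_sqrt3_less by (auto simp: y_def)
  \<comment> \<open>The tail is at most y / 12 as soon as 24 y^3 <= 1 - y^2, and y < 1/3 gives 24/27
    = 8/9 = 1 - 1/9.\<close>
  define e where "e = y / 12"
  have e: "2 * (y ^ 4 / (1 - y\<^sup>2)) \<le> e"
  proof -
    have "y * y \<le> 1/3 * (1/3)"
      using y by (intro mult_mono) auto
    then have "y\<^sup>2 \<le> 1/9" by (simp add: power2_eq_square)
    moreover have "y * y\<^sup>2 \<le> 1/3 * (1/9)"
      using y \<open>y\<^sup>2 \<le> 1/9\<close> by (intro mult_mono) auto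
    ultimately have "24 * (y * y\<^sup>2) \<le> 1 - y\<^sup>2"
      by simp
    then have "y * (24 * (y * y\<^sup>2)) \<le> y * (1 - y\<^sup>2)"
      using y by (intro mult_left_mono) auto
    then show ?thesis
      using \<open>y\<^sup>2 \<le> 1/9\<close> by (simp add: e_def field_simps power2_eq_square power4_eq_xxxx)
  qed
  define k where "k j = 2 * cos (2 * pi * real j / 9)" for j
  note k = cos_ninths[folded k_def]
  define f where "f j = (\<Sum>\<^sub>\<infinity>m\<in>(UNIV :: int set). exp (- (pi / sqrt 3 * (of_int m)\<^sup>2)) * cos (2 * pi * of_int m * (real j / 9)))" for j :: nat
  define C where "C = sqrt (pi / (pi * sqrt 3))"
  have C: "C > 0" by (simp add: C_def)
  have th: "theta9 j = C * f j" if "j \<le> 9" for j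
    using gauss_sum_poisson[of "pi * sqrt 3" "real j / 9"] that
    by (simp add: theta9_def C_def f_def power2_eq_square)
  have thth: "theta9 i * theta9 j = C\<^sup>2 * (f i * f j)" if "i \<le> 9" "j \<le> 9" for i j
    unfolding th[OF that(1)] th[OF that(2)] by (simp only: power2_eq_square mult_ac)
  have mono: "theta9 i * theta9 j < (theta9 l)\<^sup>2" if "f i * f j < f l * f l" "i \<le> 9" "j \<le> 9" "l \<le> 9" for i j l
    unfolding power2_eq_square[of "theta9 l"] thth[OF that(2,3)] thth[OF that(4,4)]
    using that(1) C by (intro mult_strict_left_mono) auto
  have fj: "\<bar>f j - (1 + y * k j)\<bar> \<le> e" for j
    using gauss_cos_sum_approx[of "pi / sqrt 3" y "real j / 9"] e
    by (simp add: y_def f_def k_def mult_ac)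
  define g where "g j = 1 + y * k j" for j
  have fg: "g j - e \<le> f j" "f j \<le> g j + e" for j
    using fj[of j] by (auto simp: g_def abs_le_iff)
  have yk: "y < y * k 1" "y / 3 < y * k 2" "y * k 2 < y" "y * k 4 < 0" "-2 * y \<le> y * k 4"
    using y k(7-11) mult_strict_left_mono[of 1 "k 1" y] mult_strict_left_mono[of "1/3" "k 2" y]
      mult_strict_left_mono[of "k 2" 1 y] mult_left_mono[of "-2" "k 4" y] by (auto simp: mult_pos_neg)
  have ysum: "y * k 1 + y * k 2 + y * k 4 = 0"
    using k(4) by (simp flip: distrib_left)
  \<comment> \<open>The gap y (\<open>k 1\<close> - \<open>k 2\<close>) has to exceed the two errors
    2 e = y / 6.\<close>
  have k1k2: "k 1 - k 2 > 1/6"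
  proof -
    have "(k 1)\<^sup>2 < (7/4)\<^sup>2"
      using k(1,9) by (simp add: power2_eq_square)
    then have "k 1 < 7/4"
      by (rule power2_less_imp_less) simp
    then have "1/4 * 2 < (2 - k 1) * (1 + k 1)"
      using k(7) by (intro mult_strict_mono) auto
    also have "\<dots> = k 1 - k 2"
      by (simp add: k(1) power2_eq_square algebra_simps)
    finally show ?thesis by simp
  qed
  have f4: "f 4 > 0"
    using fg(1)[of 4] yk(5) y by (simp add: g_def e_def)
  have f2: "f 2 > 0"
    using fg(1)[of 2] yk(2) y unfolding g_def e_def by linarith
  have "y * (1/6) < y * (k 1 - k 2)"
    using y k1k2 by (intro mult_strict_left_mono) auto
  then have f12: "f 2 < f 1"
    using fg(1)[of 1] fg(2)[of 2] by (simp add: g_def e_def right_diff_distrib)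
  have f14: "f 4 < f 1"
    using fg(1)[of 1] fg(2)[of 4] yk y unfolding g_def e_def by linarith
  have "f 2 * f 4 < f 1 * f 1"
    using f12 f14 f2 f4 by (intro mult_strict_mono) auto
  then show "theta9 2 * theta9 4 < (theta9 1)\<^sup>2"
    by (rule mono) simp_all
  have "f 1 * f 4 \<le> (g 1 + e) * (g 4 + e)"
    using fg(2)[of 1] fg(2)[of 4] f4 f12 f2 by (intro mult_mono) auto
  also have "\<dots> = g 1 * g 4 + e * (2 - y * k 2) + e * e"
  proof -
    have "(g 1 + e) * (g 4 + e) = g 1 * g 4 + e * (g 1 + g 4) + e * e"
      by (simp add: algebra_simps)
    also have "g 1 + g 4 = 2 - y * k 2"
      using ysum by (simp add: g_def)
    finally show ?thesis .
  qed
  \<comment> \<open>The main terms differ by more than y because \<open>k 2\<close> > 1/3, while the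
    errors total at most e (2 + 1/36 + 8/3) < 12 e = y.\<close>
  also have "\<dots> < (g 2 - e)\<^sup>2"
  proof -
    have b: "0 \<le> e" "e \<le> 1/36" "2 - y * k 2 \<le> 2" "g 2 \<le> 4/3"
      using y yk(2,3) unfolding e_def g_def by linarith+
    have "e * (2 - y * k 2) \<le> e * 2" "e * e \<le> e * (1/36)" "e * g 2 \<le> e * (4/3)"
      using mult_left_mono[OF b(2) b(1)] mult_left_mono[OF b(3) b(1)] mult_left_mono[OF b(4) b(1)] by simp_all
    then have "e * (2 - y * k 2) + e * e + 2 * (e * g 2) < y"
      using y(1) e_def by linarith
    also have "y < 3 * (y * k 2)"
      using yk(2) by linarith
    also have "\<dots> \<le> 3 * (y * k 2) + y\<^sup>2 * ((k 2)\<^sup>2 - k 1 * k 4)"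
    proof -
      have "k 1 * k 4 \<le> 0"
        using k(7,10) by (intro mult_nonneg_nonpos) auto
      then have "0 \<le> y\<^sup>2 * ((k 2)\<^sup>2 - k 1 * k 4)"
        by (intro mult_nonneg_nonneg) (auto intro: order_trans)
      then show ?thesis by linarith
    qed
    also have "\<dots> = (g 2)\<^sup>2 - g 1 * g 4"
    proof -
      have "(g 2)\<^sup>2 - g 1 * g 4 = 2 * (y * k 2) - (y * k 1 + y * k 4) + y\<^sup>2 * ((k 2)\<^sup>2 - k 1 * k 4)"
        by (simp add: g_def power2_eq_square algebra_simps)
      also have "y * k 1 + y * k 4 = - (y * k 2)"
        using ysum by simp
      finally show ?thesis by simp
    qed
    finally have "g 1 * g 4 + e * (2 - y * k 2) + e * e < (g 2)\<^sup>2 - 2 * (e * g 2)"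
      by linarith
    also have "\<dots> \<le> (g 2 - e)\<^sup>2"
      by (simp add: power2_eq_square algebra_simps)
    finally show ?thesis .
  qed
  also have "\<dots> \<le> (f 2)\<^sup>2"
  proof (rule power_mono)
    show "g 2 - e \<le> f 2" by (rule fg)
    show "0 \<le> g 2 - e"
      using yk(2) y unfolding g_def e_def by linarith
  qed
  finally have "f 1 * f 4 < (f 2)\<^sup>2" .
  then have "f 1 * f 4 < f 2 * f 2"
    unfolding power2_eq_square[of "f 2"] .
  then show "theta9 1 * theta9 4 < (theta9 2)\<^sup>2"
    by (rule mono) simp_all
qed

section \<open>Algebraic relations between the theta values\<close>

lemma ramanujan_phi_exp: "ramanujan_phi (exp (- c)) = gauss_sum c 0"
proof -
  have "exp (- c) powi (n\<^sup>2) = exp (- (c * (of_int n + 0)\<^sup>2))" for n :: int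
    by (simp add: power_int_def mult.commute flip: exp_of_nat_mult)
  then show ?thesis
    by (simp add: ramanujan_phi_def gauss_sum_def)
qed

lemma theta9_sub: "j \<le> 9 \<Longrightarrow> theta9 (9 - j) = theta9 j"
  using gauss_sum_add_int[of "pi * sqrt 3" "- (real j / 9)" 1] gauss_sum_uminus[of "pi * sqrt 3" "real j / 9"]
  by (simp add: theta9_def of_nat_diff diff_divide_distrib)

text \<open>The cyclic identity is taken at 1/9, 0 and -1/9, the product identity at 0 and 1/9.
  Periodicity and evenness reduce all characteristics to 0, 1, 2, 3, 4 ninths, and comparison
  eliminates the unknown constants.\<close>

lemma theta9_cubic_relations:
  fixes A B :: real
  defines "A \<equiv> gauss_sum (pi * sqrt 3 / 3) 0" and "B \<equiv> gauss_sum (pi * sqrt 3 / 3) (1/3)"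
  shows "(theta9 1)\<^sup>2 * theta9 4 + (theta9 4)\<^sup>2 * theta9 2 + (theta9 2)\<^sup>2 * theta9 1 =
      (theta9 0)\<^sup>2 * theta9 3 + (theta9 3) ^ 3 + (theta9 3)\<^sup>2 * theta9 0"
    and "((theta9 1)\<^sup>2 * theta9 2 + (theta9 2)\<^sup>2 * theta9 4 + (theta9 4)\<^sup>2 * theta9 1) * B =
      ((theta9 1)\<^sup>2 * theta9 4 + (theta9 4)\<^sup>2 * theta9 2 + (theta9 2)\<^sup>2 * theta9 1) * A"
    and "theta9 1 * theta9 2 * theta9 4 * A = theta9 0 * (theta9 3)\<^sup>2 * B"
proof -
  let ?G = "gauss_sum (pi * sqrt 3)"
  have c: "pi * sqrt 3 > 0" by simp
  have sub: "theta9 5 = theta9 4" "theta9 6 = theta9 3" "theta9 7 = theta9 2"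
    using theta9_sub[of 4] theta9_sub[of 3] theta9_sub[of 2] by simp_all
  have G: "?G 0 = theta9 0" "?G (1/9) = theta9 1" "?G (- (1/9)) = theta9 1" "?G (2/9) = theta9 2" "?G (1/3) = theta9 3"
    "?G (4/9) = theta9 4" "?G (5/9) = theta9 4" "?G (2/3) = theta9 3" "?G (7/9) = theta9 2"
    using gauss_sum_uminus[of "pi * sqrt 3" "1/9"] sub
    by (simp_all add: theta9_def)
  have B: "gauss_sum (pi * sqrt 3 / 3) (2/3) = B"
    using gauss_sum_add_int[of "pi * sqrt 3 / 3" "- (1/3)" 1] gauss_sum_uminus[of "pi * sqrt 3 / 3" "1/3"]
    by (simp add: B_def)
  obtain C where C: "\<And>\<alpha>. (?G \<alpha>)\<^sup>2 * ?G (\<alpha> + 1/3) + (?G (\<alpha> + 1/3))\<^sup>2 * ?G (\<alpha> + 2/3)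
    + (?G (\<alpha> + 2/3))\<^sup>2 * ?G \<alpha> = C * gauss_sum (pi * sqrt 3 / 3) (3 * \<alpha> + 1/3)"
    using gauss_sum_cyclic[OF c] by blast
  have C1: "(theta9 1)\<^sup>2 * theta9 4 + (theta9 4)\<^sup>2 * theta9 2 + (theta9 2)\<^sup>2 * theta9 1 = C * B"
    using C[of "1/9"] by (simp add: G B)
  have C0: "(theta9 0)\<^sup>2 * theta9 3 + (theta9 3) ^ 3 + (theta9 3)\<^sup>2 * theta9 0 = C * B"
    using C[of 0] by (simp add: G B_def power3_eq_cube power2_eq_square)
  have C2: "(theta9 1)\<^sup>2 * theta9 2 + (theta9 2)\<^sup>2 * theta9 4 + (theta9 4)\<^sup>2 * theta9 1 = C * A"
    using C[of "- 1/9"] by (simp add: G A_def)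
  show "(theta9 1)\<^sup>2 * theta9 4 + (theta9 4)\<^sup>2 * theta9 2 + (theta9 2)\<^sup>2 * theta9 1 =
      (theta9 0)\<^sup>2 * theta9 3 + (theta9 3) ^ 3 + (theta9 3)\<^sup>2 * theta9 0"
    using C1 C0 by simp
  show "((theta9 1)\<^sup>2 * theta9 2 + (theta9 2)\<^sup>2 * theta9 4 + (theta9 4)\<^sup>2 * theta9 1) * B =
      ((theta9 1)\<^sup>2 * theta9 4 + (theta9 4)\<^sup>2 * theta9 2 + (theta9 2)\<^sup>2 * theta9 1) * A"
    unfolding C1 C2 by simp
  obtain C' where C': "\<And>\<alpha>. ?G \<alpha> * (?G (\<alpha> + 1/3) * ?G (\<alpha> + 2/3)) = C' * gauss_sum (pi * sqrt 3 / 3) (3 * \<alpha>)"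
    using gauss_sum_product[OF c] by blast
  have "theta9 0 * (theta9 3)\<^sup>2 = C' * A" "theta9 1 * theta9 2 * theta9 4 = C' * B"
    using C'[of 0] C'[of "1/9"] by (simp_all add: G A_def B_def power2_eq_square mult_ac)
  then show "theta9 1 * theta9 2 * theta9 4 * A = theta9 0 * (theta9 3)\<^sup>2 * B"
    by simp
qed

text \<open>Complex multiplication enters here: at \<open>\<tau> = i sqrt 3\<close> one has \<open>-1/\<tau> = \<tau>/3\<close>, so inversion compares
  the sums for \<open>\<tau>\<close> and \<open>\<tau>/3\<close>, whose fourth powers are also related algebraically.\<close>

lemma theta9_special_values:
  fixes A B :: real
  defines "A \<equiv> gauss_sum (pi * sqrt 3 / 3) 0" and "B \<equiv> gauss_sum (pi * sqrt 3 / 3) (1/3)"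
  shows "2 * theta9 3 = root 3 2 * theta9 0"
    and "(2 * B / A) ^ 3 = 2 * (1 + root 3 2 + (root 3 2)\<^sup>2)"
proof -
  define s where "s = root 3 2"
  have s3: "s ^ 3 = 2" and s0: "s > 0"
    by (simp_all add: s_def)
  have A0: "A > 0"
    unfolding A_def by (rule gauss_sum_pos) simp
  note t0 = theta9_pos[of 0]
  have sq: "sqrt 3 * sqrt 3 = 3" by simp
  have r: "pi / (pi * sqrt 3 / 3) = sqrt 3" "pi\<^sup>2 / (pi * sqrt 3 / 3) = pi * sqrt 3"
    using sq by (simp_all add: field_simps power2_eq_square)
  have "A = sqrt (sqrt 3) * theta9 0"
    using gauss_sum_inversion[of "pi * sqrt 3 / 3"] unfolding r by (simp add: A_def theta9_def)
  moreover have "sqrt (sqrt 3) ^ 4 = ((sqrt (sqrt 3))\<^sup>2)\<^sup>2"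
    unfolding power_mult[symmetric] by simp
  ultimately have A4: "A ^ 4 = 3 * theta9 0 ^ 4"
    by (simp add: power_mult_distrib)
  \<comment> \<open>Together with A^4 = 3 \<open>theta9 0\<close>^4 from inversion, this makes the
    cube of 2 \<open>theta9 3\<close> / \<open>theta9 0\<close> equal to 2.\<close>
  have "A ^ 4 = theta9 0 ^ 4 + 8 * theta9 0 * theta9 3 ^ 3"
    using gauss_sum_fourth_power[of "pi * sqrt 3 / 9"] by (simp add: A_def theta9_def)
  moreover have "theta9 0 * (2 * theta9 3) ^ 3 = 8 * theta9 0 * theta9 3 ^ 3"
    by (simp add: power_mult_distrib)
  moreover have "theta9 0 ^ 4 = theta9 0 * theta9 0 ^ 3"
    by (simp add: power4_eq_xxxx power3_eq_cube)
  ultimately have "theta9 0 * (theta9 0 ^ 3 * 2) = theta9 0 * (2 * theta9 3) ^ 3"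
    using A4 by linarith
  then have "(2 * theta9 3) ^ 3 = (s * theta9 0) ^ 3"
    using t0 by (simp add: power_mult_distrib s3)
  then show t3: "2 * theta9 3 = root 3 2 * theta9 0"
    using power_eq_imp_eq_base[of "2 * theta9 3" 3 "s * theta9 0"] t0 theta9_pos[of 3] s0
    by (simp add: s_def)
  \<comment> \<open>The sum at parameter pi sqrt 3 / 9 is computed twice: by trisection from
    \<open>theta9\<close>, and by the fourth-power identity from A and B.\<close>
  have "gauss_sum (pi * sqrt 3 / 9) 0 = theta9 0 + theta9 3 + theta9 6"
    using gauss_sum_multisection[of "pi * sqrt 3 / 9" 3 0] by (simp add: theta9_def eval_nat_numeral)
  then have "gauss_sum (pi * sqrt 3 / 9) 0 = (1 + s) * theta9 0"
    using theta9_sub[of 3] t3 by (simp add: s_def algebra_simps)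
  moreover have "gauss_sum (pi * sqrt 3 / 9) 0 ^ 4 = A ^ 4 + 8 * A * B ^ 3"
    using gauss_sum_fourth_power[of "pi * sqrt 3 / 27"] by (simp add: A_def B_def)
  moreover have "A ^ 4 + 8 * A * B ^ 3 = A ^ 4 * (1 + (2 * B / A) ^ 3)"
    using A0 by (simp add: field_simps power4_eq_xxxx power3_eq_cube)
  ultimately have "(1 + s) ^ 4 * theta9 0 ^ 4 = 3 * (1 + (2 * B / A) ^ 3) * theta9 0 ^ 4"
    using A4 by (simp add: power_mult_distrib)
  then have "(1 + s) ^ 4 = 3 * (1 + (2 * B / A) ^ 3)"
    using t0 by simp
  moreover have "(1 + s) ^ 4 = 1 + 4 * s + 6 * s\<^sup>2 + 4 * s ^ 3 + s * s ^ 3"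
    by (simp add: power4_eq_xxxx power3_eq_cube power2_eq_square algebra_simps)
  ultimately show "(2 * B / A) ^ 3 = 2 * (1 + root 3 2 + (root 3 2)\<^sup>2)"
    by (simp add: s3 flip: s_def)
qed


text \<open>The relations divided by \<open>theta9 0\<close>^3, where u 0 = 2. The ratio r = 2 B / A
  links them: the product of u 1, u 2, u 4 is s^2 r, and the second cyclic sum times r is twice the
  first, so r cancels in the last claim.\<close>

lemma theta9_special_polynomials:
  fixes s :: real and u :: "nat \<Rightarrow> real"
  defines "s \<equiv> root 3 2" and "u \<equiv> \<lambda>j. 2 * theta9 j / theta9 0"
  shows "u 3 = s"
    and "u 1 * u 2 * u 4 = 2 * root 3 (1 + s + s\<^sup>2)"
    and "(u 1)\<^sup>2 * u 4 + (u 4)\<^sup>2 * u 2 + (u 2)\<^sup>2 * u 1 = 2 * (1 + s)\<^sup>2"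
    and "(u 1 * u 2 * u 4) * ((u 1)\<^sup>2 * u 2 + (u 2)\<^sup>2 * u 4 + (u 4)\<^sup>2 * u 1) = 4 * s\<^sup>2 * (1 + s)\<^sup>2"
proof -
  define A where "A = gauss_sum (pi * sqrt 3 / 3) 0"
  define B where "B = gauss_sum (pi * sqrt 3 / 3) (1/3)"
  have AB: "A > 0" "B > 0"
    unfolding A_def B_def by (rule gauss_sum_pos, simp)+
  note rel = theta9_cubic_relations[folded A_def B_def]
  note val = theta9_special_values[folded A_def B_def s_def]
  define t0 where "t0 = theta9 0"
  have t0: "t0 > 0" by (simp add: t0_def theta9_pos)
  have s3: "s ^ 3 = 2" "s > 0"
    by (simp_all add: s_def)
  show u3: "u 3 = s"
    using val(1) t0 by (simp add: u_def t0_def)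
  have u0: "u 0 = 2"
    using t0 by (simp add: u_def t0_def)
  define r where "r = 2 * B / A"
  have r: "r > 0" "B = r * A / 2"
    using AB by (simp_all add: r_def)
  have uu: "(u i)\<^sup>2 * u j = 8 / t0 ^ 3 * ((theta9 i)\<^sup>2 * theta9 j)" for i j
    by (simp add: u_def t0_def power2_eq_square power3_eq_cube)
  have e3: "u 1 * u 2 * u 4 = s\<^sup>2 * r"
  proof -
    have "u 1 * u 2 * u 4 * A = 8 / t0 ^ 3 * (theta9 1 * theta9 2 * theta9 4 * A)"
      by (simp add: u_def t0_def power3_eq_cube)
    also have "\<dots> = 8 / t0 ^ 3 * ((theta9 3)\<^sup>2 * theta9 0) * B"
      unfolding rel(3) by simp
    also have "\<dots> = s\<^sup>2 * r * A"
      unfolding uu[symmetric] u0 u3 r(2) by simp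
    finally show ?thesis
      using AB by simp
  qed
  have "(s\<^sup>2 * r) ^ 3 = (s ^ 3)\<^sup>2 * r ^ 3"
    by (simp add: power_mult_distrib flip: power_mult)
  also have "\<dots> = (2 * root 3 (1 + s + s\<^sup>2)) ^ 3"
    using val(2) s3 by (simp add: power_mult_distrib r_def)
  finally have "s\<^sup>2 * r = 2 * root 3 (1 + s + s\<^sup>2)"
    by (rule power_eq_imp_eq_base) (use r s3 in \<open>auto intro!: add_nonneg_nonneg\<close>)
  then show "u 1 * u 2 * u 4 = 2 * root 3 (1 + s + s\<^sup>2)"
    using e3 by simp
  have "(u 1)\<^sup>2 * u 4 + (u 4)\<^sup>2 * u 2 + (u 2)\<^sup>2 * u 1 = (u 0)\<^sup>2 * u 3 + (u 3)\<^sup>2 * u 3 + (u 3)\<^sup>2 * u 0"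
    unfolding uu distrib_left[symmetric] rel(1) by (simp add: power2_eq_square power3_eq_cube)
  then have "(u 1)\<^sup>2 * u 4 + (u 4)\<^sup>2 * u 2 + (u 2)\<^sup>2 * u 1 = 4 * s + s ^ 3 + 2 * s\<^sup>2"
    unfolding u0 u3 by (simp add: power2_eq_square power3_eq_cube)
  then show e1: "(u 1)\<^sup>2 * u 4 + (u 4)\<^sup>2 * u 2 + (u 2)\<^sup>2 * u 1 = 2 * (1 + s)\<^sup>2"
    by (simp add: s3 power2_eq_square algebra_simps)
  define S where "S = (u 1)\<^sup>2 * u 2 + (u 2)\<^sup>2 * u 4 + (u 4)\<^sup>2 * u 1"
  have "S * B = ((u 1)\<^sup>2 * u 4 + (u 4)\<^sup>2 * u 2 + (u 2)\<^sup>2 * u 1) * A"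
    unfolding S_def uu distrib_left[symmetric] mult.assoc[of "8 / t0 ^ 3"] rel(2) ..
  then have "S * r * A = 2 * (2 * (1 + s)\<^sup>2) * A"
    unfolding e1 r(2) by simp
  then have "S * r = 2 * (2 * (1 + s)\<^sup>2)"
    unfolding mult_cancel_right using AB by simp
  moreover have "u 1 * u 2 * u 4 * S = s\<^sup>2 * (S * r)"
    unfolding e3 by (simp only: mult_ac)
  ultimately have "u 1 * u 2 * u 4 * S = s\<^sup>2 * (2 * (2 * (1 + s)\<^sup>2))"
    by (simp only:)
  also have "\<dots> = 4 * s\<^sup>2 * (1 + s)\<^sup>2"
    by simp
  finally show "(u 1 * u 2 * u 4) * ((u 1)\<^sup>2 * u 2 + (u 2)\<^sup>2 * u 4 + (u 4)\<^sup>2 * u 1) = 4 * s\<^sup>2 * (1 + s)\<^sup>2"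
    unfolding S_def .
qed

text \<open>Inversion sends 27 pi sqrt 3 to pi sqrt 3 / 81 with factor (27 sqrt 3)^(-1/2) =
  3^(-7/4); since 81 = 9^2, splitting modulo 9 lands on the \<open>theta9\<close> values, which pair
  up under j -> 9 - j.\<close>

lemma ramanujan_phi_ratio:
  "ramanujan_phi (exp (- (27 * pi * sqrt 3))) / ramanujan_phi (exp (- (pi * sqrt 3))) =
    3 powr (- (7 / 4)) * ((theta9 0 + 2 * theta9 1 + 2 * theta9 2 + 2 * theta9 3 + 2 * theta9 4) / theta9 0)"
proof -
  have sq: "sqrt 3 * sqrt 3 = 3" by simp
  have r: "pi / (27 * pi * sqrt 3) = 1 / (27 * sqrt 3)" "pi\<^sup>2 / (27 * pi * sqrt 3) = pi * sqrt 3 / 81"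
    using sq by (simp_all add: field_simps power2_eq_square)
  have "27 * sqrt 3 = 3 powr (7 / 2)"
    using powr_add[of 3 3 "1 / 2 :: real"] by (simp add: powr_half_sqrt)
  then have "1 / (27 * sqrt 3) = 3 powr (- (7 / 2))"
    by (simp add: powr_minus_divide)
  then have c: "sqrt (1 / (27 * sqrt 3)) = 3 powr (- (7 / 4))"
    by (simp add: powr_powr flip: powr_half_sqrt)
  have "gauss_sum (27 * pi * sqrt 3) 0 = 3 powr (- (7 / 4)) * gauss_sum (pi * sqrt 3 / 81) 0"
    using gauss_sum_inversion[of "27 * pi * sqrt 3"] unfolding r c by simp
  also have "gauss_sum (pi * sqrt 3 / 81) 0 = (\<Sum>j<9. theta9 j)"
    using gauss_sum_multisection[of "pi * sqrt 3 / 81" 9 0] by (simp add: theta9_def)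
  also have "\<dots> = theta9 0 + 2 * theta9 1 + 2 * theta9 2 + 2 * theta9 3 + 2 * theta9 4"
    using theta9_sub[of 1] theta9_sub[of 2] theta9_sub[of 3] theta9_sub[of 4] by (simp add: eval_nat_numeral)
  finally show ?thesis
    by (simp add: ramanujan_phi_exp theta9_def)
qed

section \<open>Solving the cubic and assembling the quotient\<close>

theorem theorem4p11:
  fixes p a :: real
  assumes p: "p = 2 * root 3 (1 + root 3 2 + 2 powr (2 / 3))"
    and a: "a = 16 * p powi (-3)"
  shows "a = 2 * (root 3 2 - 1) \<and>
    ramanujan_phi (exp (- (27 * pi * sqrt 3))) / ramanujan_phi (exp (- (pi * sqrt 3))) =
      3 powr (- (7 / 4)) *
        (1 + root 3 (p * ((1 + a * cos (4 * pi / 9)) / (1 - a * cos (pi / 9))))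
           + root 3 (p * ((1 + a * cos (2 * pi / 9)) / (1 + a * cos (4 * pi / 9))))
           + root 3 2
           + root 3 (p * ((1 - a * cos (pi / 9)) / (1 + a * cos (2 * pi / 9)))))"
proof -
  define s where "s = root 3 2"
  define u where "u j = 2 * theta9 j / theta9 0" for j
  define k where "k j = 2 * cos (2 * pi * real j / 9)" for j
  note sp = theta9_special_polynomials[folded s_def u_def]
  note k = cos_ninths[folded k_def]
  have s3: "s ^ 3 = 2" and s1: "s > 1"
    by (simp_all add: s_def)
  have "2 powr (2 / 3) = (2 powr (1 / 3)) powr (2::real)"
    by (simp add: powr_powr)
  then have s2: "2 powr (2 / 3) = s\<^sup>2"
    by (simp add: s_def root_powr_inverse)
  have p: "p = 2 * root 3 (1 + s + s\<^sup>2)"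
    using p by (simp add: s2 s_def)
  \<comment> \<open>This is s^3 - 1 = 1; it turns the reciprocal in \<open>a\<close> into a
    polynomial in s.\<close>
  have inv: "(1 + s + s\<^sup>2) * (s - 1) = 1"
    using s3 by (simp add: power2_eq_square power3_eq_cube algebra_simps)
  have pos: "1 + s + s\<^sup>2 > 0"
    using s1 by (simp add: add_pos_nonneg)
  have p3: "p ^ 3 = 8 * (1 + s + s\<^sup>2)"
    using pos by (simp add: p power_mult_distrib)
  have "p powi (-3) = inverse (p ^ 3)"
    by (simp add: power_int_minus)
  then have "a = 16 * inverse (8 * (1 + s + s\<^sup>2))"
    using a unfolding p3 by (simp only:)
  also have "\<dots> = 2 * ((1 + s + s\<^sup>2) * (s - 1)) / (1 + s + s\<^sup>2)"
    unfolding inv by (simp only: inverse_mult_distrib divide_inverse) simp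
  also have "\<dots> = 2 * (s - 1)"
    using pos by simp
  finally have a: "a = 2 * (s - 1)" .
  define P1 where "P1 = (u 2)\<^sup>2 * u 1"
  define P2 where "P2 = (u 4)\<^sup>2 * u 2"
  define P4 where "P4 = (u 1)\<^sup>2 * u 4"
  have u: "u j > 0" for j
    by (simp add: u_def theta9_pos)
  have P: "P1 > 0" "P2 > 0" "P4 > 0"
    unfolding P1_def P2_def P4_def by (intro mult_pos_pos zero_less_power u)+
  have up: "u 1 * u 2 * u 4 = p"
    using sp(2) by (simp add: p)
  have "u i * u j < (u l)\<^sup>2" if "theta9 i * theta9 j < (theta9 l)\<^sup>2" for i j l
  proof -
    have "u i * u j = (2 / theta9 0)\<^sup>2 * (theta9 i * theta9 j)" "(u l)\<^sup>2 = (2 / theta9 0)\<^sup>2 * (theta9 l)\<^sup>2"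
      by (simp_all add: u_def power2_eq_square)
    then show ?thesis
      using mult_strict_left_mono[OF that, of "(2 / theta9 0)\<^sup>2"] theta9_pos[of 0] by simp
  qed
  note ord = this[OF theta9_order(1)] this[OF theta9_order(2)]
  have P41: "P4 < P1"
    using mult_strict_right_mono[OF ord(1) u[of 1]] by (simp add: P1_def P4_def power2_eq_square mult_ac)
  have P24: "P2 < P4"
    using mult_strict_right_mono[OF ord(2) u[of 4]] by (simp add: P2_def P4_def power2_eq_square mult_ac)
  \<comment> \<open>x = a / 2, so \<open>d j\<close> = 1 + a cos (2 pi j / 9). Q is a third of P1 +
    P2 + P4, since the \<open>d j\<close> add up to 3.\<close>
  define x where "x = s - 1"
  define Q where "Q = 2 / 3 * (1 + s)\<^sup>2"
  have x: "x > 0" and Q: "Q > 0"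
    using s1 by (simp_all add: x_def Q_def)
  define d where "d j = 1 + x * k j" for j
  \<comment> \<open>Both triples are listed in decreasing order, so P4 belongs to \<open>d 2\<close>
    and P2 to \<open>d 4\<close>.\<close>
  have "P1 = Q * d 1 \<and> P4 = Q * d 2 \<and> P2 = Q * d 4"
  proof (rule sorted_roots_unique[OF P41 P24])
    have "k 2 < k 1" "k 4 < k 2"
      using k(7-10) by linarith+
    then show "Q * d 2 < Q * d 1" "Q * d 4 < Q * d 2"
      using x Q by (simp_all add: d_def)
    have d1: "d 1 + d 2 + d 4 = 3"
    proof -
      have "d 1 + d 2 + d 4 = 3 + x * (k 1 + k 2 + k 4)"
        by (simp add: d_def algebra_simps)
      then show ?thesis using k(4) by simp
    qed
    have d2: "d 1 * d 2 + d 2 * d 4 + d 4 * d 1 = 3 - 3 * x\<^sup>2"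
    proof -
      have "d 1 * d 2 + d 2 * d 4 + d 4 * d 1 =
          3 + 2 * x * (k 1 + k 2 + k 4) + x\<^sup>2 * (k 1 * k 2 + k 2 * k 4 + k 4 * k 1)"
        by (simp add: d_def power2_eq_square algebra_simps)
      then show ?thesis using k(4,5) by simp
    qed
    have d3: "d 1 * d 2 * d 4 = 1 - 3 * x\<^sup>2 - x ^ 3"
    proof -
      have "d 1 * d 2 * d 4 = 1 + x * (k 1 + k 2 + k 4) + x\<^sup>2 * (k 1 * k 2 + k 2 * k 4 + k 4 * k 1)
          + x ^ 3 * (k 1 * k 2 * k 4)"
        by (simp add: d_def power2_eq_square power3_eq_cube algebra_simps)
      then show ?thesis using k(4,5,6) by simp
    qed
    have "P1 + P4 + P2 = 3 * Q"
      using sp(3) by (simp add: P1_def P2_def P4_def Q_def)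
    also have "\<dots> = Q * (d 1 + d 2 + d 4)"
      unfolding d1 by simp
    finally show "P1 + P4 + P2 = Q * d 1 + Q * d 2 + Q * d 4"
      by (simp only: distrib_left)
    have q: "(1 + s)\<^sup>2 * (3 - 3 * x\<^sup>2) = 9 * s\<^sup>2"
    proof -
      have "(1 + s)\<^sup>2 * (3 - 3 * x\<^sup>2) = 6 * s + 9 * s\<^sup>2 - 3 * s * s ^ 3"
        by (simp add: x_def power2_eq_square power3_eq_cube algebra_simps)
      then show ?thesis by (simp add: s3)
    qed
    have "P1 * P4 + P4 * P2 + P2 * P1 = (u 1 * u 2 * u 4) * ((u 1)\<^sup>2 * u 2 + (u 2)\<^sup>2 * u 4 + (u 4)\<^sup>2 * u 1)"
      by (simp add: P1_def P2_def P4_def power2_eq_square algebra_simps)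
    also have "\<dots> = Q * (2 / 3 * (9 * s\<^sup>2))"
      unfolding sp(4) by (simp add: Q_def)
    also have "\<dots> = Q\<^sup>2 * (d 1 * d 2 + d 2 * d 4 + d 4 * d 1)"
      unfolding d2 q[symmetric] power2_eq_square[of Q] by (simp add: Q_def)
    also have "\<dots> = Q * d 1 * (Q * d 2) + Q * d 2 * (Q * d 4) + Q * d 4 * (Q * d 1)"
      by (simp add: power2_eq_square algebra_simps)
    finally show "P1 * P4 + P4 * P2 + P2 * P1 = Q * d 1 * (Q * d 2) + Q * d 2 * (Q * d 4) + Q * d 4 * (Q * d 1)" .
    have cube: "(1 + s) ^ 3 = 3 * (1 + s + s\<^sup>2)"
    proof -
      have "(1 + s) ^ 3 = 1 + 3 * s + 3 * s\<^sup>2 + s ^ 3"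
        by (simp add: power2_eq_square power3_eq_cube algebra_simps)
      then show ?thesis by (simp add: s3)
    qed
    have "1 - 3 * x\<^sup>2 - x ^ 3 = 3 * s - 1 - s ^ 3"
      by (simp add: x_def power2_eq_square power3_eq_cube algebra_simps)
    then have d3': "d 1 * d 2 * d 4 = 3 * (s - 1)"
      unfolding d3 using s3 by simp
    \<comment> \<open>The cubes give 3 Q^3 = 8 T^2, and T (s - 1) = 1, so both triple products equal
      8 T = p^3.\<close>
    define T where "T = 1 + s + s\<^sup>2"
    have "((1 + s)\<^sup>2) ^ 3 = ((1 + s) ^ 3)\<^sup>2"
      by (simp only: power_mult[symmetric] mult.commute)
    moreover have "(2 / 3 :: real) ^ 3 = 8 / 27"
      by (simp add: power3_eq_cube)
    ultimately have "Q ^ 3 = 8 / 27 * (3 * T)\<^sup>2"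
      by (simp only: Q_def power_mult_distrib[of "2 / 3"] cube T_def)
    then have Q3: "Q ^ 3 * 3 = 8 * T * T"
      by (simp add: power2_eq_square)
    have "Q ^ 3 * (d 1 * d 2 * d 4) = Q ^ 3 * 3 * (s - 1)"
      unfolding d3' by (simp only: mult.assoc)
    also have "\<dots> = 8 * T * (T * (s - 1))"
      unfolding Q3 by (simp only: mult.assoc)
    also have "\<dots> = p ^ 3"
      unfolding T_def inv p3 by simp
    also have "\<dots> = P1 * P4 * P2"
      unfolding up[symmetric] by (simp add: P1_def P2_def P4_def power2_eq_square power3_eq_cube mult_ac)
    finally have "P1 * P4 * P2 = Q ^ 3 * (d 1 * d 2 * d 4)"
      by (rule sym)
    also have "\<dots> = Q * d 1 * (Q * d 2) * (Q * d 4)"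
      by (simp add: power3_eq_cube)
    finally show "P1 * P4 * P2 = Q * d 1 * (Q * d 2) * (Q * d 4)" .
  qed
  then have PQ: "P1 = Q * d 1" "P4 = Q * d 2" "P2 = Q * d 4"
    by blast+
  have "cos (8 * pi / 9) = - cos (pi / 9)"
    using cos_diff[of pi "pi / 9"] by simp
  then have d: "1 + a * cos (2 * pi / 9) = d 1" "1 + a * cos (4 * pi / 9) = d 2" "1 - a * cos (pi / 9) = d 4"
    by (simp_all add: d_def k_def a x_def mult_ac)
  \<comment> \<open>The scale Q cancels in the quotient. It remains to see u 1^3 P2 = p P4, u 2^3 P4
    = p P1 and u 4^3 P1 = p P2, which are monomial identities because p = u 1 u 2 u 4.\<close>
  have root: "root 3 (p * (d i / d j)) = v" if "v > 0" "v ^ 3 * (Q * d j) = p * (Q * d i)" "Q * d j > 0" for i j v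
  proof -
    have "d j \<noteq> 0"
      using that(3) by auto
    then have eq: "p * (d i / d j) = v ^ 3"
      using that(2) Q by (simp add: field_simps)
    show ?thesis
      unfolding eq using that(1) real_root_power_cancel[of 3 v] by simp
  qed
  have r1: "root 3 (p * (d 2 / d 4)) = u 1"
    by (rule root[OF u]; unfold PQ[symmetric])
       (use P in \<open>simp_all add: P1_def P2_def P4_def power2_eq_square power3_eq_cube mult_ac flip: up\<close>)
  have r2: "root 3 (p * (d 1 / d 2)) = u 2"
    by (rule root[OF u]; unfold PQ[symmetric])
       (use P in \<open>simp_all add: P1_def P2_def P4_def power2_eq_square power3_eq_cube mult_ac flip: up\<close>)
  have r4: "root 3 (p * (d 4 / d 1)) = u 4"
    by (rule root[OF u]; unfold PQ[symmetric])
       (use P in \<open>simp_all add: P1_def P2_def P4_def power2_eq_square power3_eq_cube mult_ac flip: up\<close>)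
  have sum: "(theta9 0 + 2 * theta9 1 + 2 * theta9 2 + 2 * theta9 3 + 2 * theta9 4) / theta9 0 = 1 + u 1 + u 2 + u 3 + u 4"
    using theta9_pos[of 0] by (simp add: u_def add_divide_distrib)
  show ?thesis
    unfolding ramanujan_phi_ratio sum d r1 r2 r4 sp(1) s_def[symmetric]
    using a by blast
qed

end
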